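(* Suppose Assumptions A and B of the context hold. Let $\rho=1-1/G$. Fix $\theta$ and a block index $k\in\{1,\dots,G\}$. Define $z'=z(\theta,u'_{(1:G)})$ with $u'_{(1:G)}\sim\bar\pi(\cdot\mid\theta)$, and $z=z(\theta,u'_{(1:k-1)},u_{(k)},u'_{(k+1:G)})$ with $u_{(k)}\sim p_{U_{(k)}}$ independent of $u'_{(1:G)}$. Then $$\begin{pmatrix} z'\\ z\end{pmatrix}\sim \mathcal N\left(\begin{pmatrix}\tfrac12\sigma^2\\ -\tfrac12\sigma^2(1-2\rho)\end{pmatrix},\ \sigma^2\begin{pmatrix}1&\rho\\ \rho&1\end{pmatrix}\right).$$ Hence $\mathrm{Corr}(z,z')=\rho$.
   Context: Setting. The likelihood factorises as $L(\theta)=\prod_{k=1}^G L_{(k)}(\theta)$, $\theta\in\Theta$. Each $L_{(k)}(\theta)$ is estimated unbiasedly by $\widehat L_{(k)}(\theta,u_{(k)})$, where the $u_{(k)}\in\mathbb U_k$ are independent with densities $p_{U_{(k)}}$, so $\int\widehat L_{(k)}(\theta,u_{(k)})p_{U_{(k)}}(u_{(k)})\,\mathrm{d}u_{(k)}=L_{(k)}(\theta)$; $N_{(k)}$ is the number of samples used to compute $\widehat L_{(k)}$. Put $\widehat L(\theta,u)=\prod_{k=1}^G\widehat L_{(k)}(\theta,u_{(k)})$ with $u=u_{(1:G)}=(u_{(1)},\dots,u_{(G)})$. With prior density $p_\Theta$ and marginal likelihood $\bar L=\int p_\Theta(\theta)L(\theta)\,\mathrm{d}\theta$, the extended target density is $\bar\pi(\theta,u_{(1:G)})=p_\Theta(\theta)\widehat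 L(\theta,u_{(1:G)})\prod_{j=1}^G p_{U_{(j)}}(u_{(j)})/\bar L$, and $\bar\pi(\cdot\mid\theta)$ is the corresponding conditional distribution of $u_{(1:G)}$ (or of a sub-collection of its blocks) given $\theta$. Errors in the log-likelihood estimates: $z_{(k)}(\theta,u_{(k)})=\log\widehat L_{(k)}(\theta,u_{(k)})-\log L_{(k)}(\theta)$, and $z(\theta,\cdot)$ of any sub-collection of blocks is the sum of the corresponding $z_{(j)}(\theta,u_{(j)})$; in particular $z(\theta,u_{(1:G)})=\sum_{j=1}^G z_{(j)}(\theta,u_{(j)})$ and $z(\theta,u_{(1:k-1)},u_{(k+1:G)})=\sum_{j\ne k}z_{(j)}(\theta,u_{(j)})$. $\mathbb V$ denotes variance and $\mathcal N(a,b^2)$ the normal law with mean $a$ and variance $b^2$. Assumption A. Let $u_{(1)},\dots,u_{(G)}$ be independent with $u_{(k)}\sim p_{U_{(k)}}$. (i) For each $k$ there are $\gamma^2_{(k)}(\theta)>0$, $N_{(k)}>0$ and $\varpi>0$ with $\mathbb V(z_{(k)}(\theta,u_{(k)}))=\gamma_{(k)}^2(\theta)/N_{(k)}^{2\varpi}$. (ii) For a given $\sigma^2>0$, $N_{(k)}=[G\gamma^2_{(k)}(\theta)/\sigma^2]^{1/(2\varpi)}$, so that $\mathbb V(z_{(k)}(\theta,u_{(k)}))=\sigma^2/G$ and $\sigma^2=\mathbb V(z(\theta,u_{(1:G)}))$. (iii) Both $z(\theta,u_{(1:G)})$ and $z(\theta,u_{(1:k-1)},u_{(k+1:G)})$ are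 normally distributed for each $k$. Assumption B. If $u_{(k)}\sim p_{U_{(k)}}$ and $(u'_{(1:k-1)},u'_{(k+1:G)})\sim\bar\pi(\cdot\mid\theta)$ are independent, then $z_{(k)}(\theta,u_{(k)})+z(\theta,u'_{(1:k-1)},u'_{(k+1:G)})$ is normally distributed for a given $\theta$. *)

theory Defs
  imports "HOL-Probability.Probability"
begin

section \<open>Normal laws and correlation\<close>

text \<open>The univariate normal law with mean \<open>a\<close> and standard deviation \<open>b\<close>; \<open>b = 0\<close> gives the
  degenerate law, i.e. the point mass at \<open>a\<close>.\<close>

definition normal_law :: "real \<Rightarrow> real \<Rightarrow> real measure" where
  "normal_law a b =
     (if b = 0 then return borel a else density lborel (\<lambda>x. ennreal (normal_density a b x)))"

definition normally_distributed :: "'w measure \<Rightarrow> ('w \<Rightarrow> real) \<Rightarrow> bool" where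
  "normally_distributed M X \<longleftrightarrow>
     X \<in> borel_measurable M \<and> (\<exists>a b. 0 \<le> b \<and> distr M borel X = normal_law a b)"

text \<open>Density of the multivariate normal law with mean vector \<open>m\<close> and covariance matrix \<open>S\<close>;
  meaningful for symmetric positive definite \<open>S\<close>.\<close>

definition mv_normal_density :: "real ^ 'n \<Rightarrow> real ^ 'n ^ 'n \<Rightarrow> real ^ 'n \<Rightarrow> real" where
  "mv_normal_density m S x =
     exp (- ((x - m) \<bullet> (matrix_inv S *v (x - m))) / 2) / sqrt ((2 * pi) ^ CARD('n) * det S)"

definition covariance :: "'w measure \<Rightarrow> ('w \<Rightarrow> real) \<Rightarrow> ('w \<Rightarrow> real) \<Rightarrow> real" where
  "covariance M X Y = (\<integral>w. (X w - (\<integral>w. X w \<partial>M)) * (Y w - (\<integral>w. Y w \<partial>M)) \<partial>M)"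

definition correlation :: "'w measure \<Rightarrow> ('w \<Rightarrow> real) \<Rightarrow> ('w \<Rightarrow> real) \<Rightarrow> real" where
  "correlation M X Y =
     covariance M X Y / (sqrt (prob_space.variance M X) * sqrt (prob_space.variance M Y))"

text \<open>Independence of two random variables whose ranges may have different types (the library's
  \<open>indep_var\<close> requires equal types): their generated sigma-algebras are independent.\<close>

definition indep_rvs ::
    "'w measure \<Rightarrow> 'a measure \<Rightarrow> ('w \<Rightarrow> 'a) \<Rightarrow> 'b measure \<Rightarrow> ('w \<Rightarrow> 'b) \<Rightarrow> bool" where
  "indep_rvs M S X T Y \<longleftrightarrow>
     X \<in> measurable M S \<and> Y \<in> measurable M T \<and>
     prob_space.indep_set M {X -` A \<inter> space M | A. A \<in> sets S} {Y -` A \<inter> space M | A. A \<in> sets T}"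


section \<open>Blockwise estimated likelihoods\<close>

text \<open>The blocks are indexed by \<open>{1..nblocks}\<close>. The measures \<open>param_ref\<close> and \<open>aux_ref k\<close> are the
  reference measures (``\<open>d\<theta>\<close>'' and ``\<open>du\<^sub>k\<close>'') with respect to which the densities \<open>prior\<close> and
  \<open>aux_dens k\<close> are taken; the parameter set is \<open>space param_ref\<close>. Block \<open>k\<close> has its own space
  \<open>space (aux_ref k)\<close>, all of them inside one type. The sample sizes \<open>nsamples k\<close> are
  real-valued since they get prescribed by a formula that need not give an integer.\<close>

record ('t, 'u) block_model =
  nblocks :: nat
  param_ref :: "'t measure"
  prior :: "'t \<Rightarrow> real"
  aux_ref :: "nat \<Rightarrow> 'u measure"
  aux_dens :: "nat \<Rightarrow> 'u \<Rightarrow> real"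
  lik :: "nat \<Rightarrow> 't \<Rightarrow> real"
  lik_est :: "nat \<Rightarrow> 't \<Rightarrow> 'u \<Rightarrow> real"
  nsamples :: "nat \<Rightarrow> real"

definition blocks :: "('t, 'u) block_model \<Rightarrow> nat set" where
  "blocks B = {1..nblocks B}"

definition full_lik :: "('t, 'u) block_model \<Rightarrow> 't \<Rightarrow> real" where
  "full_lik B \<theta> = (\<Prod>k\<in>blocks B. lik B k \<theta>)"

definition full_lik_est :: "('t, 'u) block_model \<Rightarrow> 't \<Rightarrow> (nat \<Rightarrow> 'u) \<Rightarrow> real" where
  "full_lik_est B \<theta> u = (\<Prod>k\<in>blocks B. lik_est B k \<theta> (u k))"

definition marginal_lik :: "('t, 'u) block_model \<Rightarrow> real" where
  "marginal_lik B = (\<integral>\<theta>. prior B \<theta> * full_lik B \<theta> \<partial>param_ref B)"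

text \<open>Unbiasedness is stated by \<open>has_bochner_integral\<close>, which includes integrability.
  Positivity of the marginal likelihood makes the extended target density below well defined.\<close>

definition valid_block_model :: "('t, 'u) block_model \<Rightarrow> bool" where
  "valid_block_model B \<longleftrightarrow>
     sigma_finite_measure (param_ref B) \<and>
     prior B \<in> borel_measurable (param_ref B) \<and>
     (\<forall>\<theta>\<in>space (param_ref B). 0 \<le> prior B \<theta>) \<and>
     has_bochner_integral (param_ref B) (prior B) 1 \<and>
     (\<forall>k\<in>blocks B.
        sigma_finite_measure (aux_ref B k) \<and>
        aux_dens B k \<in> borel_measurable (aux_ref B k) \<and>
        (\<forall>u\<in>space (aux_ref B k). 0 \<le> aux_dens B k u) \<and>
        has_bochner_integral (aux_ref B k) (aux_dens B k) 1 \<and>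
        (\<lambda>(\<theta>, u). lik_est B k \<theta> u) \<in> borel_measurable (param_ref B \<Otimes>\<^sub>M aux_ref B k) \<and>
        (\<forall>\<theta>\<in>space (param_ref B).
           (\<forall>u\<in>space (aux_ref B k). 0 \<le> lik_est B k \<theta> u) \<and>
           has_bochner_integral (aux_ref B k) (\<lambda>u. lik_est B k \<theta> u * aux_dens B k u) (lik B k \<theta>))) \<and>
     integrable (param_ref B) (\<lambda>\<theta>. prior B \<theta> * full_lik B \<theta>) \<and>
     0 < marginal_lik B"

text \<open>The law of a single block, and the joint law of independent blocks, under \<open>aux_dens\<close>.\<close>

definition block_law :: "('t, 'u) block_model \<Rightarrow> nat \<Rightarrow> 'u measure" where
  "block_law B k = density (aux_ref B k) (\<lambda>u. ennreal (aux_dens B k u))"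

definition aux_law :: "('t, 'u) block_model \<Rightarrow> (nat \<Rightarrow> 'u) measure" where
  "aux_law B = PiM (blocks B) (block_law B)"

definition aux_space :: "('t, 'u) block_model \<Rightarrow> (nat \<Rightarrow> 'u) measure" where
  "aux_space B = PiM (blocks B) (aux_ref B)"

definition target_dens :: "('t, 'u) block_model \<Rightarrow> 't \<Rightarrow> (nat \<Rightarrow> 'u) \<Rightarrow> real" where
  "target_dens B \<theta> u =
     prior B \<theta> * full_lik_est B \<theta> u * (\<Prod>j\<in>blocks B. aux_dens B j (u j)) / marginal_lik B"

text \<open>The conditional density of the blocks given \<open>\<theta>\<close>: joint density over \<open>\<theta>\<close>-marginal density.
  It is meaningful only where the latter is positive.\<close>

definition target_cond_dens :: "('t, 'u) block_model \<Rightarrow> 't \<Rightarrow> (nat \<Rightarrow> 'u) \<Rightarrow> real" where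
  "target_cond_dens B \<theta> u = target_dens B \<theta> u / (\<integral>v. target_dens B \<theta> v \<partial>aux_space B)"

definition target_cond :: "('t, 'u) block_model \<Rightarrow> 't \<Rightarrow> (nat \<Rightarrow> 'u) measure" where
  "target_cond B \<theta> = density (aux_space B) (\<lambda>u. ennreal (target_cond_dens B \<theta> u))"

text \<open>The conditional law given \<open>\<theta>\<close> of the sub-collection of the blocks in \<open>J\<close>.\<close>

definition target_cond_sub :: "('t, 'u) block_model \<Rightarrow> 't \<Rightarrow> nat set \<Rightarrow> (nat \<Rightarrow> 'u) measure" where
  "target_cond_sub B \<theta> J = distr (target_cond B \<theta>) (PiM J (aux_ref B)) (\<lambda>u. restrict u J)"


section \<open>Errors in the log-likelihood estimates\<close>

text \<open>Since \<open>ln 0 = 0\<close> here, this is the intended error only where the estimate is positive.\<close>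

definition log_err :: "('t, 'u) block_model \<Rightarrow> nat \<Rightarrow> 't \<Rightarrow> 'u \<Rightarrow> real" where
  "log_err B k \<theta> u = ln (lik_est B k \<theta> u) - ln (lik B k \<theta>)"

definition sub_log_err :: "('t, 'u) block_model \<Rightarrow> nat set \<Rightarrow> 't \<Rightarrow> (nat \<Rightarrow> 'u) \<Rightarrow> real" where
  "sub_log_err B J \<theta> u = (\<Sum>j\<in>J. log_err B j \<theta> (u j))"

text \<open>The variances below are positive, so they are genuine: the variance of a random variable
  that is not square integrable is \<open>0\<close> by convention. With a single block the error of the empty
  sub-collection is \<open>0\<close>, which counts as (degenerate) normal.\<close>

definition assumption_A ::
    "('t, 'u) block_model \<Rightarrow> 't \<Rightarrow> (nat \<Rightarrow> 't \<Rightarrow> real) \<Rightarrow> real \<Rightarrow> real \<Rightarrow> bool" where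
  "assumption_A B \<theta> \<gamma> \<omega> \<sigma> \<longleftrightarrow>
     0 < \<omega> \<and> 0 < \<sigma>\<^sup>2 \<and>
     (\<forall>k\<in>blocks B.
        0 < (\<gamma> k \<theta>)\<^sup>2 \<and> 0 < nsamples B k \<and>
        prob_space.variance (aux_law B) (\<lambda>u. log_err B k \<theta> (u k)) =
          (\<gamma> k \<theta>)\<^sup>2 / nsamples B k powr (2 * \<omega>)) \<and>
     (\<forall>k\<in>blocks B.
        nsamples B k = (real (nblocks B) * (\<gamma> k \<theta>)\<^sup>2 / \<sigma>\<^sup>2) powr (1 / (2 * \<omega>))) \<and>
     normally_distributed (aux_law B) (sub_log_err B (blocks B) \<theta>) \<and>
     (\<forall>k\<in>blocks B. normally_distributed (aux_law B) (sub_log_err B (blocks B - {k}) \<theta>))"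

definition assumption_B :: "('t, 'u) block_model \<Rightarrow> 't \<Rightarrow> bool" where
  "assumption_B B \<theta> \<longleftrightarrow>
     (\<forall>k\<in>blocks B.
        normally_distributed (block_law B k \<Otimes>\<^sub>M target_cond_sub B \<theta> (blocks B - {k}))
          (\<lambda>(v, u'). log_err B k \<theta> v + sub_log_err B (blocks B - {k}) \<theta> u'))"

end

theory Submission
  imports Defs
begin

text \<open>Under the target conditional law the blocks stay independent and each is exponentially tilted by
  its own error, because \<open>lik_est / lik = exp log_err\<close> almost surely. Writing \<open>W\<close> and \<open>W'\<close> for the error
  of block \<open>k\<close> at the fresh and at the target variable, and \<open>X\<close> for the error of the other blocks at
  the target variable, we get \<open>z' = W' + X\<close> and \<open>z = W + X\<close> with \<open>W, W', X\<close> independent. The untilted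
  errors of all the blocks and of all but block \<open>k\<close> are normal with variances \<open>\<sigma>\<^sup>2\<close> and
  \<open>\<sigma>\<^sup>2 (1 - 1/G)\<close>, so dividing characteristic functions makes \<open>W\<close> normal with variance \<open>\<sigma>\<^sup>2/G\<close>.
  Unbiasedness forces the mean of a normal error with variance \<open>b\<^sup>2\<close> to be \<open>-b\<^sup>2/2\<close>, and tilting moves
  it to \<open>b\<^sup>2/2\<close>. Conditioning on \<open>X\<close> and completing the square gives the joint density.\<close>

section \<open>Normal laws\<close>

text \<open>An affine image of the standard normal covers the point mass at \<open>b = 0\<close> as
  well, so characteristic functions and moments follow by change of variables with no case split
  later on.\<close>

lemma normal_law_eq_distr:
  assumes "0 \<le> b"
  shows "normal_law a b = distr std_normal_distribution borel (\<lambda>x. a + b * x)"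
proof (cases "b = 0")
  case True
  interpret prob_space std_normal_distribution
    by (rule prob_space_normal_density) simp
  show ?thesis
    using True by (simp add: normal_law_def distr_const)
next
  case False
  interpret prob_space std_normal_distribution
    by (rule prob_space_normal_density) simp
  \<comment> \<open>\<open>normal_density_affine\<close> speaks of a random variable with a normal
    density; on the standard normal space the identity serves as one.\<close>
  have "distributed std_normal_distribution lborel (\<lambda>x. x) std_normal_density"
    unfolding distributed_def by (auto intro!: measure_eqI simp: emeasure_distr)
  from normal_density_affine[OF this, of b a] False assms
  have "distr std_normal_distribution lborel (\<lambda>x. a + b * x) = density lborel (normal_density a b)"
    by (simp add: distributed_def)
  moreover have "distr std_normal_distribution lborel (\<lambda>x. a + b * x)
      = distr std_normal_distribution borel (\<lambda>x. a + b * x)"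
    by (rule distr_cong) auto
  ultimately show ?thesis
    using False by (simp add: normal_law_def)
qed

lemma sets_normal_law [simp, measurable_cong]: "sets (normal_law a b) = sets borel"
  by (simp add: normal_law_def)

lemma space_normal_law [simp]: "space (normal_law a b) = UNIV"
  by (simp add: normal_law_def)

lemma prob_space_normal_law: "0 \<le> b \<Longrightarrow> prob_space (normal_law a b)"
  by (auto simp: normal_law_def prob_space_return prob_space_normal_density)

lemma char_normal_law:
  assumes "0 \<le> b"
  shows "char (normal_law a b) t = iexp (t * a) * exp (- (b * t)\<^sup>2 / 2)"
proof -
  have "char (normal_law a b) t
      = (CLINT x|std_normal_distribution. iexp (t * a) * iexp (b * t * x))"
    unfolding char_def normal_law_eq_distr[OF assms]
    by (subst integral_distr) (auto simp: algebra_simps exp_add)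
  also have "\<dots> = iexp (t * a) * char std_normal_distribution (b * t)"
    unfolding char_def by (rule integral_mult_right_zero)
  finally show ?thesis
    by (simp add: char_std_normal_distribution)
qed

text \<open>A normal characteristic function never vanishes, so it can be cancelled from the
  product; Levy uniqueness then identifies the other factor. This recovers the law of one block from
  the laws of all blocks and of all but that one. The case \<open>b = 0\<close> is included, since
  it occurs for a single block.\<close>

lemma normal_law_deconvolution:
  assumes "real_distribution \<nu>" "0 \<le> b" "b \<le> b'"
    and eq: "\<And>t. char (normal_law a b) t * char \<nu> t = char (normal_law a' b') t"
  shows "\<nu> = normal_law (a' - a) (sqrt (b'\<^sup>2 - b\<^sup>2))"
proof (rule Levy_uniqueness)
  show "real_distribution (normal_law (a' - a) (sqrt (b'\<^sup>2 - b\<^sup>2)))"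
    by (intro real_distribution.intro real_distribution_axioms.intro prob_space_normal_law)
      (use assms in \<open>auto intro: power_mono\<close>)
  have b: "b\<^sup>2 \<le> b'\<^sup>2" using assms by (auto intro: power_mono)
  show "char \<nu> = char (normal_law (a' - a) (sqrt (b'\<^sup>2 - b\<^sup>2)))"
  proof
    fix t
    have m: "iexp (t * a) * iexp (t * (a' - a)) = iexp (t * a')"
      by (simp add: exp_add[symmetric] algebra_simps)
    have v: "exp (- (b * t)\<^sup>2 / 2) * exp (- (sqrt (b'\<^sup>2 - b\<^sup>2) * t)\<^sup>2 / 2)
        = exp (- (b' * t)\<^sup>2 / 2)"
      using b by (simp add: exp_add[symmetric] power_mult_distrib field_simps)
    have "char (normal_law a b) t * char (normal_law (a' - a) (sqrt (b'\<^sup>2 - b\<^sup>2))) t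
        = (iexp (t * a) * iexp (t * (a' - a)))
          * of_real (exp (- (b * t)\<^sup>2 / 2) * exp (- (sqrt (b'\<^sup>2 - b\<^sup>2) * t)\<^sup>2 / 2))"
      using assms(2) b by (simp only: char_normal_law real_sqrt_ge_zero diff_ge_0_iff_ge of_real_mult)
        (simp only: mult_ac)
    also have "\<dots> = char (normal_law a' b') t"
      using assms by (simp only: m v char_normal_law)
    finally have "char (normal_law a b) t * char (normal_law (a' - a) (sqrt (b'\<^sup>2 - b\<^sup>2))) t
        = char (normal_law a' b') t" .
    moreover have "char (normal_law a b) t \<noteq> 0"
      using assms by (simp add: char_normal_law)
    ultimately show "char \<nu> t = char (normal_law (a' - a) (sqrt (b'\<^sup>2 - b\<^sup>2))) t"
      using eq[of t] by (metis mult_left_cancel)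
  qed
qed (fact assms)

text \<open>Completing the square: tilting by \<open>exp\<close> moves the mean by the variance,
  keeps the variance, and leaves the moment generating function at 1 as a constant factor.\<close>

lemma exp_mult_normal_density:
  assumes "b \<noteq> 0"
  shows "exp x * normal_density a b x = exp (a + b\<^sup>2 / 2) * normal_density (a + b\<^sup>2) b x"
proof -
  have "x + - (x - a)\<^sup>2 / (2 * b\<^sup>2) = (a + b\<^sup>2 / 2) + - (x - (a + b\<^sup>2))\<^sup>2 / (2 * b\<^sup>2)"
    using assms by (simp add: field_simps power2_eq_square)
  then show ?thesis
    by (simp add: normal_density_def exp_add[symmetric])
qed

text \<open>The moment generating function at 1. Unbiasedness later forces this value to be 1, which
  pins down the mean \<open>a\<close>.\<close>

lemma nn_integral_exp_normal_law:
  assumes "0 \<le> b"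
  shows "(\<integral>\<^sup>+x. ennreal (exp x) \<partial>normal_law a b) = ennreal (exp (a + b\<^sup>2 / 2))"
proof (cases "b = 0")
  case True
  then show ?thesis by (simp add: normal_law_def nn_integral_return)
next
  case False
  interpret prob_space "density lborel (normal_density (a + b\<^sup>2) b)"
    using False assms by (intro prob_space_normal_density) auto
  have "(\<integral>\<^sup>+x. ennreal (exp x) \<partial>normal_law a b)
      = (\<integral>\<^sup>+x. ennreal (exp (a + b\<^sup>2 / 2)) * ennreal (normal_density (a + b\<^sup>2) b x) \<partial>lborel)"
    using False by (simp add: normal_law_def nn_integral_density exp_mult_normal_density mult.commute
        flip: ennreal_mult)
  also have "\<dots> = ennreal (exp (a + b\<^sup>2 / 2))"
    using emeasure_space_1 by (simp add: nn_integral_cmult emeasure_density)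
  finally show ?thesis .
qed

text \<open>At mean \<open>- (b\<^sup>2 / 2)\<close> the constant factor of the tilt equals 1, so
  tilting yields a normal law again, with the sign of the mean flipped.\<close>

lemma density_exp_normal_law:
  assumes "0 \<le> b"
  shows "density (normal_law (- (b\<^sup>2 / 2)) b) (\<lambda>x. ennreal (exp x)) = normal_law (b\<^sup>2 / 2) b"
proof (cases "b = 0")
  case True
  \<comment> \<open>The tilt does nothing to the point mass at 0, because
    \<open>exp 0 = 1\<close>.\<close>
  have "emeasure (density (return borel (0::real)) (\<lambda>x. ennreal (exp x))) A = indicator A 0"
    if "A \<in> sets borel" for A
    using that by (simp add: emeasure_density nn_integral_return)
  then show ?thesis
    using True by (auto intro!: measure_eqI simp: normal_law_def)
next
  case False
  have "density (normal_law (- (b\<^sup>2 / 2)) b) (\<lambda>x. ennreal (exp x))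
      = density lborel (\<lambda>x. ennreal (exp x * normal_density (- (b\<^sup>2 / 2)) b x))"
    using False by (simp add: normal_law_def density_density_eq ennreal_mult mult.commute)
  then show ?thesis
    using exp_mult_normal_density[OF False, of _ "- (b\<^sup>2 / 2)"] False
    by (simp add: normal_law_def field_simps)
qed

section \<open>First and second moments of normal laws, degenerate ones included\<close>

lemma integrable_normal_law: "0 \<le> b \<Longrightarrow> integrable (normal_law a b) (\<lambda>x. x)"
  and integrable_normal_law_square: "0 \<le> b \<Longrightarrow> integrable (normal_law a b) (\<lambda>x. x\<^sup>2)"
  and expectation_normal_law: "0 \<le> b \<Longrightarrow> (\<integral>x. x \<partial>normal_law a b) = a"
  and variance_normal_law: "0 \<le> b \<Longrightarrow> (\<integral>x. (x - a)\<^sup>2 \<partial>normal_law a b) = b\<^sup>2"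
proof -
  assume b: "0 \<le> b"
  interpret prob_space std_normal_distribution
    by (rule prob_space_normal_density) simp
  have i1: "integrable std_normal_distribution (\<lambda>x. x)"
    using integrable_std_normal_moment[of 1]
    by (subst integrable_density) (auto simp: real_scaleR_def)
  have e1: "(\<integral>x. x \<partial>std_normal_distribution) = 0"
    using integral_std_normal_moment_odd[of 0]
    by (subst integral_density) (auto simp: real_scaleR_def)
  have i2: "integrable std_normal_distribution (\<lambda>x. x\<^sup>2)"
    using integrable_std_normal_moment[of 2]
    by (subst integrable_density) (auto simp: real_scaleR_def)
  have e2: "(\<integral>x. x\<^sup>2 \<partial>std_normal_distribution) = 1"
    using integral_std_normal_moment_even[of 1]
    by (subst integral_density) (auto simp: real_scaleR_def)
  note [simp] = i1 e1 i2 e2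
  have U: "measure std_normal_distribution UNIV = 1"
    using prob_space by simp
  show "integrable (normal_law a b) (\<lambda>x. x)"
    unfolding normal_law_eq_distr[OF b] by (subst integrable_distr_eq) auto
  show "integrable (normal_law a b) (\<lambda>x. x\<^sup>2)"
    unfolding normal_law_eq_distr[OF b]
    by (subst integrable_distr_eq) (auto simp: power2_sum power_mult_distrib mult.assoc)
  show "(\<integral>x. x \<partial>normal_law a b) = a"
    unfolding normal_law_eq_distr[OF b] by (subst integral_distr) (auto simp: U)
  show "(\<integral>x. (x - a)\<^sup>2 \<partial>normal_law a b) = b\<^sup>2"
    unfolding normal_law_eq_distr[OF b] by (subst integral_distr) (auto simp: power_mult_distrib)
qed

section \<open>Bivariate normal density\<close>

text \<open>\<open>matrix_inv\<close> is a choice among two-sided inverses, and by associativity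
  there is at most one.\<close>

lemma matrix_inv_eqI:
  fixes S T :: "real ^ 'n ^ 'n"
  assumes "S ** T = mat 1" "T ** S = mat 1"
  shows "matrix_inv S = T"
proof -
  have *: "S ** matrix_inv S = mat 1 \<and> matrix_inv S ** S = mat 1"
    unfolding matrix_inv_def using assms by (rule someI[of _ T, OF conjI])
  then have "matrix_inv S = (T ** S) ** matrix_inv S"
    using assms by simp
  also have "\<dots> = T"
    using * by (simp flip: matrix_mul_assoc)
  finally show ?thesis .
qed

text \<open>With \<open>s\<close> positive, \<open>r\<^sup>2 < 1\<close> is positive definiteness of
  the covariance matrix; the explicit inverse and determinant of a 2 by 2 matrix give the scalar
  form.\<close>

lemma mv_normal_density_2:
  assumes s: "0 < s" and r: "r\<^sup>2 < 1"
  shows "mv_normal_density (vector [p, q]) (s *\<^sub>R vector [vector [1, r], vector [r, 1]])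
           (vector [a, b] :: real ^ 2)
       = exp (- ((a - p)\<^sup>2 + (b - q)\<^sup>2 - 2 * r * (a - p) * (b - q)) / (2 * s * (1 - r\<^sup>2)))
         / (2 * pi * s * sqrt (1 - r\<^sup>2))"
proof -
  define S :: "real ^ 2 ^ 2" where "S = s *\<^sub>R vector [vector [1, r], vector [r, 1]]"
  define T :: "real ^ 2 ^ 2"
    where "T = (1 / (s * (1 - r\<^sup>2))) *\<^sub>R vector [vector [1, - r], vector [- r, 1]]"
  define t where "t = 1 / (s * (1 - r\<^sup>2))"
  \<comment> \<open>This is the diagonal entry of \<open>S ** T\<close> and of
    \<open>T ** S\<close>; the off-diagonal entries cancel identically.\<close>
  have t: "s * t - s * t * r * r = 1"
    using assms unfolding t_def by (simp add: diff_divide_distrib[symmetric] power2_eq_square)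
  have T: "T = t *\<^sub>R vector [vector [1, - r], vector [- r, 1]]"
    by (simp add: T_def t_def)
  have "matrix_inv S = T"
    using t by (intro matrix_inv_eqI)
      (simp_all add: S_def T vec_eq_iff matrix_matrix_mult_def mat_def sum_2 forall_2 algebra_simps)
  moreover have "det S = s\<^sup>2 * (1 - r\<^sup>2)"
    by (simp add: S_def det_2 power2_eq_square algebra_simps)
  moreover have "sqrt ((2 * pi)\<^sup>2 * (s\<^sup>2 * (1 - r\<^sup>2))) = 2 * pi * s * sqrt (1 - r\<^sup>2)"
    using s by (simp add: real_sqrt_mult)
  moreover have "(vector [a, b] - vector [p, q]) \<bullet> (T *v (vector [a, b] - vector [p, q]))
      = t * ((a - p)\<^sup>2 + (b - q)\<^sup>2 - 2 * r * (a - p) * (b - q))"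
    by (simp add: T inner_vec_def matrix_vector_mult_def sum_2 power2_eq_square algebra_simps)
  moreover have "- (t * Q) / 2 = - Q / (2 * s * (1 - r\<^sup>2))" for Q
  proof -
    have "- (1 / (s * k) * Q) / 2 = - Q / (2 * s * k)" for k
      by simp
    then show ?thesis
      unfolding t_def .
  qed
  moreover have "CARD(2) = 2"
    by simp
  ultimately show ?thesis
    by (simp only: mv_normal_density_def S_def[symmetric])
qed

lemma borel_measurable_vector_2 [measurable]:
  "(\<lambda>x. vector [fst x, snd x] :: real ^ 2) \<in> borel_measurable (borel \<Otimes>\<^sub>M borel)"
proof -
  have "continuous_on UNIV (\<lambda>x :: real \<times> real. (\<chi> i. if i = 1 then fst x else snd x) :: real ^ 2)"
  proof (rule continuous_on_vec_lambda)
    show "continuous_on UNIV (\<lambda>x :: real \<times> real. if i = 1 then fst x else snd x)" for i :: 2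
      by (cases "i = 1") (auto intro: continuous_intros)
  qed
  then have "(\<lambda>x :: real \<times> real. (\<chi> i. if i = 1 then fst x else snd x) :: real ^ 2)
      \<in> borel_measurable (borel \<Otimes>\<^sub>M borel)"
    unfolding borel_prod by (rule borel_measurable_continuous_onI)
  moreover have "(\<lambda>x. vector [fst x, snd x] :: real ^ 2) = (\<lambda>x. \<chi> i. if i = 1 then fst x else snd x)"
    by (simp add: fun_eq_iff vec_eq_iff forall_2)
  ultimately show ?thesis
    by simp
qed

text \<open>Lebesgue measure is determined by its values on boxes, and a box in the plane is a
  product of two intervals. The identity turns integrals over \<open>real ^ 2\<close> into iterated
  integrals.\<close>

lemma lborel_vector_2:
  "lborel = distr (lborel \<Otimes>\<^sub>M lborel) borel (\<lambda>x. vector [fst x, snd x] :: real ^ 2)"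
proof (rule lborel_eqI)
  fix l u :: "real ^ 2"
  assume "\<And>b. b \<in> Basis \<Longrightarrow> l \<bullet> b \<le> u \<bullet> b"
  from this[of "axis 1 1"] this[of "axis 2 1"] have le: "l $ 1 \<le> u $ 1" "l $ 2 \<le> u $ 2"
    by (simp_all add: axis_in_Basis_iff inner_axis)
  have "(\<lambda>x. vector [fst x, snd x]) -` box l u = {l $ 1<..<u $ 1} \<times> {l $ 2<..<u $ 2}"
    by (auto simp: mem_box_cart forall_2)
  then have "emeasure (distr (lborel \<Otimes>\<^sub>M lborel) borel (\<lambda>x. vector [fst x, snd x] :: real ^ 2)) (box l u)
      = emeasure lborel {l $ 1<..<u $ 1} * emeasure lborel {l $ 2<..<u $ 2}"
    by (subst emeasure_distr) (auto simp: space_pair_measure lborel.emeasure_pair_measure_Times)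
  also have "\<dots> = ennreal (u $ 1 - l $ 1) * ennreal (u $ 2 - l $ 2)"
    using le by simp
  also have "\<dots> = (\<Prod>b\<in>Basis. (u - l) \<bullet> b)"
    using le by (simp add: Basis_vec_def inner_axis axis_eq_axis UNIV_2 ennreal_mult mult.commute)
  finally show "emeasure (distr (lborel \<Otimes>\<^sub>M lborel) borel (\<lambda>x. vector [fst x, snd x] :: real ^ 2)) (box l u)
      = (\<Prod>b\<in>Basis. (u - l) \<bullet> b)" .
qed simp

lemma nn_integral_vector_2:
  assumes [measurable]: "f \<in> borel_measurable borel"
  shows "(\<integral>\<^sup>+x. f x \<partial>lborel) = (\<integral>\<^sup>+a. \<integral>\<^sup>+b. f (vector [a, b] :: real ^ 2) \<partial>lborel \<partial>lborel)"
  by (subst lborel_vector_2, subst nn_integral_distr)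
    (auto simp: lborel.nn_integral_fst[symmetric])

text \<open>Translation invariance of Lebesgue measure, with the substitution
  \<open>a = w + x\<close>.\<close>

lemma nn_integral_normal_law_shift:
  assumes [measurable]: "f \<in> borel_measurable borel" and "s \<noteq> 0"
  shows "(\<integral>\<^sup>+w. f (w + x) \<partial>normal_law m s)
       = (\<integral>\<^sup>+a. f a * ennreal (normal_density m s (a - x)) \<partial>lborel)"
  using nn_integral_real_affine[of "\<lambda>a. f a * ennreal (normal_density m s (a - x))" 1 x] assms
  by (simp add: normal_law_def nn_integral_density ac_simps)

text \<open>The left side is the exponent of the product of three centred normal densities:
  \<open>y\<close> for the common summand with variance \<open>c * d\<close>, and
  \<open>A - y\<close>, \<open>B - y\<close> for the two private summands with variance
  \<open>c\<close>. The square is completed in \<open>y\<close>: the first term on the right is the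
  exponent of the bivariate normal, the second that of a normal density in \<open>y\<close>.\<close>

lemma complete_square:
  fixes c d q A B y :: real
  assumes "c \<noteq> 0" "d \<noteq> 0" "q \<noteq> 0" and q: "q = 2 * d + 1"
  shows "- y\<^sup>2 / (2 * (c * d)) + (- (A - y)\<^sup>2 / (2 * c) + - (B - y)\<^sup>2 / (2 * c))
        = - ((d + 1) * (A\<^sup>2 + B\<^sup>2) - 2 * d * A * B) / (2 * c * q)
          + - (y - d * (A + B) / q)\<^sup>2 / (2 * (c * d / q))"
proof -
  \<comment> \<open>The conditional mean of the common summand given the two sums; using
    \<open>q * u\<close> keeps the main identity polynomial.\<close>
  define u where "u = d * (A + B) / q"
  have u: "q * u = d * (A + B)" using assms by (simp add: u_def)
  have "- y\<^sup>2 / (2 * (c * d)) + (- (A - y)\<^sup>2 / (2 * c) + - (B - y)\<^sup>2 / (2 * c))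
     = - (q * (y\<^sup>2 + d * ((A - y)\<^sup>2 + (B - y)\<^sup>2))) / (2 * c * d * q)"
    using assms(1-3) by (simp add: divide_simps) (simp add: algebra_simps)
  also have "q * (y\<^sup>2 + d * ((A - y)\<^sup>2 + (B - y)\<^sup>2))
      = d * ((d + 1) * (A\<^sup>2 + B\<^sup>2) - 2 * d * A * B) + (q * y - d * (A + B))\<^sup>2"
    unfolding q by (simp add: power2_eq_square algebra_simps)
  also have "q * y - d * (A + B) = q * (y - u)"
    by (simp add: u algebra_simps)
  also have "- (d * ((d + 1) * (A\<^sup>2 + B\<^sup>2) - 2 * d * A * B) + (q * (y - u))\<^sup>2) / (2 * c * d * q)
     = - ((d + 1) * (A\<^sup>2 + B\<^sup>2) - 2 * d * A * B) / (2 * c * q) + - (y - u)\<^sup>2 / (2 * (c * d / q))"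
    using assms(1-3) by (simp add: divide_simps power_mult_distrib) (simp add: power2_eq_square algebra_simps)
  finally show ?thesis by (simp add: u_def)
qed

text \<open>Given a common summand equal to \<open>x\<close>, the two sums have independent normal
  densities; averaging over \<open>x\<close> leaves the bivariate normal. Each sum has variance
  \<open>c + c * d\<close> and they share \<open>c * d\<close>, whence the correlation
  \<open>d / (d + 1)\<close>.\<close>

lemma normal_mixture_density:
  assumes c: "0 < c" and d: "0 \<le> d"
  shows "(\<integral>\<^sup>+x. ennreal (normal_density m1 (sqrt c) (a - x) * normal_density m2 (sqrt c) (b - x))
             \<partial>normal_law m3 (sqrt (c * d)))
       = ennreal (mv_normal_density (vector [m1 + m3, m2 + m3])
           ((c * (d + 1)) *\<^sub>R vector [vector [1, d / (d + 1)], vector [d / (d + 1), 1]])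
           (vector [a, b] :: real ^ 2))"
proof -
  define A B where "A = a - m1 - m3" and "B = b - m2 - m3"
  define D where "D = exp (- ((d + 1) * (A\<^sup>2 + B\<^sup>2) - 2 * d * A * B) / (2 * c * (2 * d + 1)))
    / (2 * pi * c * sqrt (2 * d + 1))"
  have r: "(d / (d + 1))\<^sup>2 < 1"
    using d by (simp add: power_less_one_iff abs_square_less_1)
  have r': "1 - (d / (d + 1))\<^sup>2 = (2 * d + 1) / (d + 1)\<^sup>2"
    using d by (simp add: power_divide divide_simps) (simp add: power2_eq_square algebra_simps)
  have cd: "0 < c * (d + 1)"
    using c d by simp
  have AB: "a - (m1 + m3) = A" "b - (m2 + m3) = B"
    by (simp_all add: A_def B_def)
  have num: "A\<^sup>2 + B\<^sup>2 - 2 * (d / (d + 1)) * A * B = ((d + 1) * (A\<^sup>2 + B\<^sup>2) - 2 * d * A * B) / (d + 1)"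
    using d by (simp add: divide_simps)
  have den: "2 * (c * (d + 1)) * ((2 * d + 1) / (d + 1)\<^sup>2) = 2 * c * (2 * d + 1) / (d + 1)"
    using d by (simp add: power2_eq_square)
  have "mv_normal_density (vector [m1 + m3, m2 + m3])
           ((c * (d + 1)) *\<^sub>R vector [vector [1, d / (d + 1)], vector [d / (d + 1), 1]])
           (vector [a, b] :: real ^ 2)
     = exp (- (A\<^sup>2 + B\<^sup>2 - 2 * (d / (d + 1)) * A * B) / (2 * (c * (d + 1)) * ((2 * d + 1) / (d + 1)\<^sup>2)))
         / (2 * pi * (c * (d + 1)) * sqrt ((2 * d + 1) / (d + 1)\<^sup>2))"
    unfolding mv_normal_density_2[OF cd r] r' AB ..
  also have "- (A\<^sup>2 + B\<^sup>2 - 2 * (d / (d + 1)) * A * B) / (2 * (c * (d + 1)) * ((2 * d + 1) / (d + 1)\<^sup>2))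
      = - ((d + 1) * (A\<^sup>2 + B\<^sup>2) - 2 * d * A * B) / (2 * c * (2 * d + 1))"
    unfolding num den using d by simp
  also have "2 * pi * (c * (d + 1)) * sqrt ((2 * d + 1) / (d + 1)\<^sup>2) = 2 * pi * c * sqrt (2 * d + 1)"
    using c d by (simp add: real_sqrt_divide)
  finally have mv: "mv_normal_density (vector [m1 + m3, m2 + m3])
           ((c * (d + 1)) *\<^sub>R vector [vector [1, d / (d + 1)], vector [d / (d + 1), 1]])
           (vector [a, b] :: real ^ 2) = D"
    by (simp add: D_def)
  have nd: "normal_density m (sqrt c) y = exp (- (y - m)\<^sup>2 / (2 * c)) / sqrt (2 * pi * c)" for m y
    using c by (simp add: normal_density_def)
  have "(\<integral>\<^sup>+x. ennreal (normal_density m1 (sqrt c) (a - x) * normal_density m2 (sqrt c) (b - x))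
             \<partial>normal_law m3 (sqrt (c * d))) = ennreal D"
  proof (cases "d = 0")
    case True
    \<comment> \<open>For \<open>d = 0\<close> the common summand is the point mass at
      \<open>m3\<close>, and the covariance matrix is diagonal.\<close>
    have "normal_density m1 (sqrt c) (a - m3) * normal_density m2 (sqrt c) (b - m3) = D"
      using c True by (simp add: nd D_def A_def B_def exp_add[symmetric] field_simps)
    then show ?thesis
      using True by (simp add: normal_law_def nn_integral_return)
  next
    case False
    \<comment> \<open>\<open>s\<close> and \<open>\<mu>\<close> are the standard deviation and the
      mean of the common summand given the two sums, as supplied by completing the square.\<close>
    define s where "s = sqrt (c * d / (2 * d + 1))"
    define \<mu> where "\<mu> = m3 + d * (A + B) / (2 * d + 1)"
    have s: "0 < s" "s\<^sup>2 = c * d / (2 * d + 1)"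
      using c d False by (auto simp: s_def)
    have "normal_density m3 (sqrt (c * d)) x
        * (normal_density m1 (sqrt c) (a - x) * normal_density m2 (sqrt c) (b - x))
        = D * normal_density \<mu> s x" for x
    proof -
      define y where "y = x - m3"
      have "- y\<^sup>2 / (2 * (c * d)) + (- (A - y)\<^sup>2 / (2 * c) + - (B - y)\<^sup>2 / (2 * c))
        = - ((d + 1) * (A\<^sup>2 + B\<^sup>2) - 2 * d * A * B) / (2 * c * (2 * d + 1))
          + - (y - d * (A + B) / (2 * d + 1))\<^sup>2 / (2 * (c * d / (2 * d + 1)))"
        using c d False by (intro complete_square) auto
      then have e: "exp (- y\<^sup>2 / (2 * (c * d))) * (exp (- (A - y)\<^sup>2 / (2 * c)) * exp (- (B - y)\<^sup>2 / (2 * c)))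
        = exp (- ((d + 1) * (A\<^sup>2 + B\<^sup>2) - 2 * d * A * B) / (2 * c * (2 * d + 1)))
          * exp (- (y - d * (A + B) / (2 * d + 1))\<^sup>2 / (2 * (c * d / (2 * d + 1))))"
        by (simp only: exp_add[symmetric])
      \<comment> \<open>The normalising constants factor in the same way as the exponents: one part
        for \<open>D\<close>, one for the normal density in \<open>x\<close>.\<close>
      have k: "sqrt (2 * pi * (c * d)) * (sqrt (2 * pi * c) * sqrt (2 * pi * c))
        = (2 * pi * c * sqrt (2 * d + 1)) * sqrt (2 * pi * (c * d / (2 * d + 1)))"
      proof -
        have "sqrt (2 * pi * (c * d)) = sqrt (2 * d + 1) * sqrt (2 * pi * (c * d / (2 * d + 1)))"
          using d by (simp flip: real_sqrt_mult)
        moreover have "sqrt (2 * pi * c) * sqrt (2 * pi * c) = 2 * pi * c"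
          using c by simp
        ultimately show ?thesis
          by simp
      qed
      have "normal_density m3 (sqrt (c * d)) x
          * (normal_density m1 (sqrt c) (a - x) * normal_density m2 (sqrt c) (b - x))
        = (exp (- y\<^sup>2 / (2 * (c * d))) * (exp (- (A - y)\<^sup>2 / (2 * c)) * exp (- (B - y)\<^sup>2 / (2 * c))))
          / (sqrt (2 * pi * (c * d)) * (sqrt (2 * pi * c) * sqrt (2 * pi * c)))"
        using c d by (simp add: nd) (simp add: normal_density_def y_def A_def B_def algebra_simps)
      also have "\<dots> = D * normal_density \<mu> s x"
        unfolding e k
        by (simp add: D_def normal_density_def s(2) \<mu>_def y_def algebra_simps)
      finally show ?thesis .
    qed
    then have "(\<integral>\<^sup>+x. ennreal (normal_density m1 (sqrt c) (a - x) * normal_density m2 (sqrt c) (b - x))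
             \<partial>normal_law m3 (sqrt (c * d)))
        = (\<integral>\<^sup>+x. ennreal D * ennreal (normal_density \<mu> s x) \<partial>lborel)"
      using c False d by (simp add: normal_law_def nn_integral_density D_def flip: ennreal_mult)
    also have "\<dots> = ennreal D"
      using prob_space.emeasure_space_1[OF prob_space_normal_density[OF s(1)]]
      by (simp add: nn_integral_cmult emeasure_density)
    finally show ?thesis .
  qed
  then show ?thesis
    by (simp only: mv)
qed

section \<open>Joint laws and moments\<close>

lemma distr_snd_prob:
  assumes "prob_space N" "sigma_finite_measure M" shows "distr (N \<Otimes>\<^sub>M M) M snd = M"
proof -
  interpret N: prob_space N by fact
  interpret M: sigma_finite_measure M by fact
  show ?thesis
  proof (rule measure_eqI)
    fix A assume A: "A \<in> sets (distr (N \<Otimes>\<^sub>M M) M snd)"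
    then have "snd -` A \<inter> space (N \<Otimes>\<^sub>M M) = space N \<times> A"
      using sets.sets_into_space by (auto simp: space_pair_measure)
    then show "emeasure (distr (N \<Otimes>\<^sub>M M) M snd) A = emeasure M A"
      using A by (simp add: emeasure_distr M.emeasure_pair_measure_Times N.emeasure_space_1)
  qed simp
qed

lemma (in prob_space) joint_law_marginals:
  assumes [measurable]: "random_variable S X" "random_variable T Y"
    and P: "prob_space P" "sets P = sets S" and Q: "prob_space Q" "sets Q = sets T"
    and law: "distr M (S \<Otimes>\<^sub>M T) (\<lambda>w. (X w, Y w)) = P \<Otimes>\<^sub>M Q"
  shows "distr M S X = P" "distr M T Y = Q"
proof -
  have "distr M S X = distr (distr M (S \<Otimes>\<^sub>M T) (\<lambda>w. (X w, Y w))) S fst"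
    by (subst distr_distr) (auto simp: comp_def)
  also have "\<dots> = distr (P \<Otimes>\<^sub>M Q) P fst"
    unfolding law by (rule distr_cong) (simp_all add: P)
  also have "\<dots> = P"
    using Q by (simp add: prob_space.distr_pair_fst)
  finally show "distr M S X = P" .
  have "distr M T Y = distr (distr M (S \<Otimes>\<^sub>M T) (\<lambda>w. (X w, Y w))) T snd"
    by (subst distr_distr) (auto simp: comp_def)
  also have "\<dots> = distr (P \<Otimes>\<^sub>M Q) Q snd"
    unfolding law by (rule distr_cong) (simp_all add: Q)
  also have "\<dots> = Q"
    using P Q by (simp add: distr_snd_prob prob_space_imp_sigma_finite)
  finally show "distr M T Y = Q" .
qed

text \<open>Any product form of the joint law with probability factors already has the marginals as
  its factors, so they need not be known beforehand.\<close>

lemma (in prob_space) indep_var_if_joint_law: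
  assumes "random_variable S X" "random_variable T Y"
    and "prob_space P" "sets P = sets S" "prob_space Q" "sets Q = sets T"
    and "distr M (S \<Otimes>\<^sub>M T) (\<lambda>w. (X w, Y w)) = P \<Otimes>\<^sub>M Q"
  shows "indep_var S X T Y"
  unfolding indep_var_distribution_eq using assms joint_law_marginals[OF assms] by simp

text \<open>Applied to the projections of a pair, this extracts pairwise independence from the law
  of a triple.\<close>

lemma (in prob_space) joint_law_compose:
  assumes [measurable]: "random_variable S X" "random_variable T Y" "g \<in> measurable T U"
    and P: "sets P = sets S" and Q: "prob_space Q" "sets Q = sets T"
    and law: "distr M (S \<Otimes>\<^sub>M T) (\<lambda>w. (X w, Y w)) = P \<Otimes>\<^sub>M Q"
  shows "distr M (S \<Otimes>\<^sub>M U) (\<lambda>w. (X w, g (Y w))) = P \<Otimes>\<^sub>M distr Q U g"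
proof -
  note [measurable_cong] = P Q(2)
  have "distr M (S \<Otimes>\<^sub>M U) (\<lambda>w. (X w, g (Y w)))
      = distr (distr M (S \<Otimes>\<^sub>M T) (\<lambda>w. (X w, Y w))) (S \<Otimes>\<^sub>M U) (\<lambda>(x, y). (x, g y))"
    by (subst distr_distr) (auto simp: comp_def)
  also have "\<dots> = distr P S (\<lambda>x. x) \<Otimes>\<^sub>M distr Q U g"
    unfolding law
  proof (rule pair_measure_distr[symmetric])
    show "sigma_finite_measure (distr Q U g)"
      using Q by (intro prob_space_imp_sigma_finite prob_space.prob_space_distr) auto
  qed measurable
  also have "distr P S (\<lambda>x. x) = P"
    using P by (intro distr_id2) simp
  finally show ?thesis .
qed

lemma (in prob_space)
  assumes X: "random_variable borel X" and law: "distr M borel X = normal_law a b" and b: "0 \<le> b"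
  shows integrable_if_normal_law: "integrable M X"
    and integrable_square_if_normal_law: "integrable M (\<lambda>w. (X w)\<^sup>2)"
    and variance_if_normal_law: "variance X = b\<^sup>2"
proof -
  show "integrable M X"
    using integrable_normal_law[OF b, of a, folded law] by (rule integrable_distr[OF X])
  show "integrable M (\<lambda>w. (X w)\<^sup>2)"
    using integrable_normal_law_square[OF b, of a, folded law] by (rule integrable_distr[OF X])
  have "expectation X = (\<integral>x. x \<partial>normal_law a b)"
    unfolding law[symmetric] by (rule integral_distr[OF X, symmetric]) simp
  then have a: "expectation X = a"
    by (simp only: expectation_normal_law[OF b])
  have "expectation (\<lambda>w. (X w - a)\<^sup>2) = (\<integral>x. (x - a)\<^sup>2 \<partial>normal_law a b)"
    unfolding law[symmetric] by (rule integral_distr[OF X, symmetric]) simp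
  then show "variance X = b\<^sup>2"
    by (simp only: a variance_normal_law[OF b])
qed

section \<open>Sums with a common independent summand\<close>

context prob_space
begin

lemma integrable_centred_square:
  fixes X :: "'a \<Rightarrow> real"
  assumes "integrable M X" "integrable M (\<lambda>w. (X w)\<^sup>2)"
  shows "integrable M (\<lambda>w. (X w - a)\<^sup>2)"
  using assms by (simp add: power2_diff)

text \<open>After centring, the three mixed products have mean zero by pairwise independence, and
  only the square of the common part survives.\<close>

lemma covariance_add_common:
  fixes P Q R :: "'a \<Rightarrow> real"
  assumes P: "integrable M P" and Q: "integrable M Q"
    and R: "integrable M R" "integrable M (\<lambda>w. (R w)\<^sup>2)"
    and ind: "indep_var borel P borel Q" "indep_var borel P borel R" "indep_var borel Q borel R"
  shows "covariance M (\<lambda>w. P w + R w) (\<lambda>w. Q w + R w) = variance R"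
proof -
  define p q r where "p w = P w - expectation P" and "q w = Q w - expectation Q"
    and "r w = R w - expectation R" for w
  have i: "integrable M p" "integrable M q" "integrable M r"
    unfolding p_def q_def r_def using P Q R by auto
  have z: "expectation p = 0" "expectation q = 0" "expectation r = 0"
    unfolding p_def q_def r_def using P Q R by (auto simp: prob_space)
  have "indep_var borel ((\<lambda>x. x - expectation P) \<circ> P) borel ((\<lambda>x. x - expectation Q) \<circ> Q)"
    "indep_var borel ((\<lambda>x. x - expectation P) \<circ> P) borel ((\<lambda>x. x - expectation R) \<circ> R)"
    "indep_var borel ((\<lambda>x. x - expectation Q) \<circ> Q) borel ((\<lambda>x. x - expectation R) \<circ> R)"
    by (rule indep_var_compose[OF ind(1)] indep_var_compose[OF ind(2)] indep_var_compose[OF ind(3)];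
        measurable)+
  then have "indep_var borel p borel q" "indep_var borel p borel r" "indep_var borel q borel r"
    by (simp_all add: comp_def p_def[abs_def] q_def[abs_def] r_def[abs_def])
  note indep = this
  note prod = indep_var_integrable[OF indep(1) i(1,2)] indep_var_integrable[OF indep(2) i(1,3)]
    indep_var_integrable[OF indep(3) i(2,3)]
  note exps = indep_var_lebesgue_integral[OF indep(1) i(1,2)] indep_var_lebesgue_integral[OF indep(2) i(1,3)]
    indep_var_lebesgue_integral[OF indep(3) i(2,3)]
  have rr: "integrable M (\<lambda>w. (r w)\<^sup>2)"
    unfolding r_def by (intro integrable_centred_square R)
  have "covariance M (\<lambda>w. P w + R w) (\<lambda>w. Q w + R w)
      = expectation (\<lambda>w. (p w * q w + p w * r w) + (q w * r w + (r w)\<^sup>2))"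
    unfolding covariance_def using P Q R
    by (intro Bochner_Integration.integral_cong)
      (auto simp: p_def q_def r_def algebra_simps power2_eq_square)
  also have "\<dots> = expectation (\<lambda>w. (r w)\<^sup>2)"
    using prod exps rr by (simp add: z)
  finally show ?thesis
    by (simp add: r_def)
qed

lemma variance_add_indep:
  fixes P R :: "'a \<Rightarrow> real"
  assumes P: "integrable M P" "integrable M (\<lambda>w. (P w)\<^sup>2)"
    and R: "integrable M R" "integrable M (\<lambda>w. (R w)\<^sup>2)"
    and ind: "indep_var borel P borel R"
  shows "variance (\<lambda>w. P w + R w) = variance P + variance R"
    and "integrable M (\<lambda>w. (P w + R w)\<^sup>2)"
proof -
  have PR: "integrable M (\<lambda>w. P w * R w)" "expectation (\<lambda>w. P w * R w) = expectation P * expectation R"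
    using indep_var_integrable[OF ind P(1) R(1)] indep_var_lebesgue_integral[OF ind P(1) R(1)]
    by auto
  show sq: "integrable M (\<lambda>w. (P w + R w)\<^sup>2)"
    using P R PR by (simp add: power2_sum mult.assoc)
  have "expectation (\<lambda>w. (P w + R w)\<^sup>2)
      = expectation (\<lambda>w. (P w)\<^sup>2) + expectation (\<lambda>w. (R w)\<^sup>2) + 2 * (expectation P * expectation R)"
    using P R PR by (simp add: power2_sum mult.assoc)
  moreover have "variance (\<lambda>w. P w + R w)
      = expectation (\<lambda>w. (P w + R w)\<^sup>2) - (expectation (\<lambda>w. P w + R w))\<^sup>2"
    using P R sq by (intro variance_eq) auto
  moreover have "expectation (\<lambda>w. P w + R w) = expectation P + expectation R"
    using P R by simp
  ultimately show "variance (\<lambda>w. P w + R w) = variance P + variance R"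
    unfolding variance_eq[OF P] variance_eq[OF R] by (simp add: power2_sum)
qed

text \<open>Square integrability of the partial sums is carried through the induction, because the
  two-summand case asks for it.\<close>

lemma variance_sum_indep:
  fixes X :: "'i \<Rightarrow> 'a \<Rightarrow> real"
  assumes "finite I" "indep_vars (\<lambda>_. borel) X I"
    and "\<And>i. i \<in> I \<Longrightarrow> integrable M (X i)" "\<And>i. i \<in> I \<Longrightarrow> integrable M (\<lambda>w. (X i w)\<^sup>2)"
  shows "variance (\<lambda>w. \<Sum>i\<in>I. X i w) = (\<Sum>i\<in>I. variance (X i))
    \<and> integrable M (\<lambda>w. (\<Sum>i\<in>I. X i w)\<^sup>2)"
  using assms
proof (induction I)
  case empty
  then show ?case by (simp add: prob_space)
next
  case (insert i I)
  have IH: "variance (\<lambda>w. \<Sum>i\<in>I. X i w) = (\<Sum>i\<in>I. variance (X i))"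
    "integrable M (\<lambda>w. (\<Sum>i\<in>I. X i w)\<^sup>2)"
    using insert.IH[OF indep_vars_subset[OF insert.prems(1)]] insert.prems by auto
  show ?case
    using variance_add_indep[of "X i" "\<lambda>w. \<Sum>i\<in>I. X i w"]
      indep_vars_sum[OF insert.hyps insert.prems(1)] insert.prems insert.hyps IH
    by simp
qed

end

section \<open>The bivariate normal law of two normals with a common summand\<close>

lemma borel_measurable_mv_normal_density [measurable]:
  fixes m :: "real ^ 'n"
  shows "mv_normal_density m S \<in> borel_measurable borel"
proof -
  have "continuous_on UNIV (\<lambda>x. mv_normal_density m S x)"
    unfolding mv_normal_density_def divide_inverse
    by (intro continuous_intros linear_continuous_on_compose[of _ _ "\<lambda>x. matrix_inv S *v x"]
        matrix_vector_mul_linear)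
  then show ?thesis
    by (rule borel_measurable_continuous_onI)
qed

text \<open>\<open>W\<close> and \<open>W'\<close> are the private summands with variance
  \<open>c\<close>, and \<open>X\<close> is the common one with variance \<open>c * d\<close>. The
  law lists \<open>W\<close> first, whereas the vector starts with \<open>W' + X\<close>; hence
  \<open>m1\<close> belongs to \<open>W'\<close> and \<open>m2\<close> to \<open>W\<close>.\<close>

lemma distributed_normal_common_summand:
  assumes "prob_space M" and c: "0 < c" and d: "0 \<le> d"
    and [measurable]: "W \<in> borel_measurable M" "W' \<in> borel_measurable M" "X \<in> borel_measurable M"
    and law: "distr M (borel \<Otimes>\<^sub>M (borel \<Otimes>\<^sub>M borel)) (\<lambda>w. (W w, (W' w, X w)))
      = normal_law m2 (sqrt c) \<Otimes>\<^sub>M (normal_law m1 (sqrt c) \<Otimes>\<^sub>M normal_law m3 (sqrt (c * d)))"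
  shows "distributed M lborel (\<lambda>w. vector [W' w + X w, W w + X w] :: real ^ 2)
    (\<lambda>x. ennreal (mv_normal_density (vector [m1 + m3, m2 + m3])
           ((c * (d + 1)) *\<^sub>R vector [vector [1, d / (d + 1)], vector [d / (d + 1), 1]]) x))"
proof -
  let ?D = "mv_normal_density (vector [m1 + m3, m2 + m3])
           ((c * (d + 1)) *\<^sub>R vector [vector [1, d / (d + 1)], vector [d / (d + 1), 1]])
    :: real ^ 2 \<Rightarrow> real"
  let ?n1 = "\<lambda>x. ennreal (normal_density m1 (sqrt c) x)"
  let ?n2 = "\<lambda>x. ennreal (normal_density m2 (sqrt c) x)"
  interpret prob_space M by fact
  interpret N1: prob_space "normal_law m1 (sqrt c)" using c by (intro prob_space_normal_law) auto
  interpret N2: prob_space "normal_law m2 (sqrt c)" using c by (intro prob_space_normal_law) auto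
  interpret N3: prob_space "normal_law m3 (sqrt (c * d))"
    using c d by (intro prob_space_normal_law) auto
  interpret N13: pair_prob_space "normal_law m1 (sqrt c)" "normal_law m3 (sqrt (c * d))" ..
  interpret N23: pair_prob_space "normal_law m2 (sqrt c)" "normal_law m3 (sqrt (c * d))" ..
  interpret L3: pair_sigma_finite lborel "normal_law m3 (sqrt (c * d))" ..
  have V [measurable]: "(\<lambda>w. vector [W' w + X w, W w + X w] :: real ^ 2) \<in> borel_measurable M"
    using borel_measurable_vector_2[THEN measurable_compose_rev, of "\<lambda>w. (W' w + X w, W w + X w)" M]
    by simp
  have vec2 [measurable]: "(\<lambda>x. vector [f x, g x] :: real ^ 2) \<in> borel_measurable N"
    if [measurable]: "f \<in> borel_measurable N" "g \<in> borel_measurable N" for f g and N :: "'z measure"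
    using borel_measurable_vector_2[THEN measurable_compose_rev, of "\<lambda>w. (f w, g w)" N]
    by simp
  have "distr M lborel (\<lambda>w. vector [W' w + X w, W w + X w] :: real ^ 2) = density lborel ?D"
  proof (rule measure_eqI)
    fix A assume "A \<in> sets (distr M lborel (\<lambda>w. vector [W' w + X w, W w + X w] :: real ^ 2))"
    then have A [measurable]: "A \<in> sets borel" by simp
    define f :: "real \<Rightarrow> real \<Rightarrow> ennreal" where "f a b = indicator A (vector [a, b] :: real ^ 2)" for a b
    have f [measurable]: "(\<lambda>x. f (g x) (h x)) \<in> borel_measurable N"
      if [measurable]: "g \<in> borel_measurable N" "h \<in> borel_measurable N" for g h and N :: "'z measure"
      unfolding f_def by measurable
    have "emeasure (distr M lborel (\<lambda>w. vector [W' w + X w, W w + X w] :: real ^ 2)) A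
        = (\<integral>\<^sup>+w. f (W' w + X w) (W w + X w) \<partial>M)"
      unfolding f_def by (subst nn_integral_indicator[symmetric], simp, subst nn_integral_distr) auto
    also have "\<dots> = (\<integral>\<^sup>+(w, (w', x)). f (w' + x) (w + x)
        \<partial>distr M (borel \<Otimes>\<^sub>M (borel \<Otimes>\<^sub>M borel)) (\<lambda>w. (W w, (W' w, X w))))"
      by (subst nn_integral_distr) (auto simp: case_prod_unfold)
    also have "\<dots> = (\<integral>\<^sup>+w. \<integral>\<^sup>+w'. \<integral>\<^sup>+x. f (w' + x) (w + x)
        \<partial>normal_law m3 (sqrt (c * d)) \<partial>normal_law m1 (sqrt c) \<partial>normal_law m2 (sqrt c))"
      unfolding law
      by (simp add: N13.nn_integral_fst[symmetric] N3.nn_integral_fst[symmetric] case_prod_unfold)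
    \<comment> \<open>Two exchanges move the common summand outermost, so that for fixed
      \<open>x\<close> the private summands can be shifted to the coordinates \<open>a\<close> and
      \<open>b\<close>.\<close>
    also have "\<dots> = (\<integral>\<^sup>+w. \<integral>\<^sup>+x. \<integral>\<^sup>+w'. f (w' + x) (w + x)
        \<partial>normal_law m1 (sqrt c) \<partial>normal_law m3 (sqrt (c * d)) \<partial>normal_law m2 (sqrt c))"
      by (intro nn_integral_cong N13.Fubini'[symmetric]) simp
    also have "\<dots> = (\<integral>\<^sup>+x. \<integral>\<^sup>+w. \<integral>\<^sup>+w'. f (w' + x) (w + x)
        \<partial>normal_law m1 (sqrt c) \<partial>normal_law m2 (sqrt c) \<partial>normal_law m3 (sqrt (c * d)))"
      by (intro N23.Fubini'[symmetric]) simp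
    also have "\<dots> = (\<integral>\<^sup>+x. \<integral>\<^sup>+b. (\<integral>\<^sup>+a. f a b * ?n1 (a - x) \<partial>lborel) * ?n2 (b - x)
        \<partial>lborel \<partial>normal_law m3 (sqrt (c * d)))"
    proof (intro nn_integral_cong)
      fix x
      have "(\<integral>\<^sup>+w'. f (w' + x) (w + x) \<partial>normal_law m1 (sqrt c))
          = (\<integral>\<^sup>+a. f a (w + x) * ?n1 (a - x) \<partial>lborel)" for w
        using c by (intro nn_integral_normal_law_shift[of "\<lambda>a. f a (w + x)"]) auto
      then show "(\<integral>\<^sup>+w. \<integral>\<^sup>+w'. f (w' + x) (w + x) \<partial>normal_law m1 (sqrt c) \<partial>normal_law m2 (sqrt c))
          = (\<integral>\<^sup>+b. (\<integral>\<^sup>+a. f a b * ?n1 (a - x) \<partial>lborel) * ?n2 (b - x) \<partial>lborel)"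
        using c by (simp add: nn_integral_normal_law_shift[of "\<lambda>b. \<integral>\<^sup>+a. f a b * ?n1 (a - x) \<partial>lborel"])
    qed
    also have "\<dots> = (\<integral>\<^sup>+x. \<integral>\<^sup>+b. \<integral>\<^sup>+a. f a b * (?n1 (a - x) * ?n2 (b - x))
        \<partial>lborel \<partial>lborel \<partial>normal_law m3 (sqrt (c * d)))"
      by (simp add: mult.assoc flip: nn_integral_multc)
    \<comment> \<open>Now the common summand travels back to the innermost place, where the mixture
      formula integrates it out.\<close>
    also have "\<dots> = (\<integral>\<^sup>+b. \<integral>\<^sup>+x. \<integral>\<^sup>+a. f a b * (?n1 (a - x) * ?n2 (b - x))
        \<partial>lborel \<partial>normal_law m3 (sqrt (c * d)) \<partial>lborel)"
      by (intro L3.Fubini') simp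
    also have "\<dots> = (\<integral>\<^sup>+b. \<integral>\<^sup>+a. \<integral>\<^sup>+x. f a b * (?n1 (a - x) * ?n2 (b - x))
        \<partial>normal_law m3 (sqrt (c * d)) \<partial>lborel \<partial>lborel)"
      by (intro nn_integral_cong L3.Fubini') simp
    also have "\<dots> = (\<integral>\<^sup>+b. \<integral>\<^sup>+a. f a b * ennreal (?D (vector [a, b])) \<partial>lborel \<partial>lborel)"
      by (simp add: nn_integral_cmult normal_mixture_density[OF c d] flip: ennreal_mult)
    also have "\<dots> = (\<integral>\<^sup>+a. \<integral>\<^sup>+b. f a b * ennreal (?D (vector [a, b])) \<partial>lborel \<partial>lborel)"
      by (intro lborel_pair.Fubini') simp
    also have "\<dots> = emeasure (density lborel ?D) A"
      by (simp add: emeasure_density nn_integral_vector_2 f_def mult.commute)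
    finally show "emeasure (distr M lborel (\<lambda>w. vector [W' w + X w, W w + X w] :: real ^ 2)) A
        = emeasure (density lborel ?D) A" .
  qed simp
  then show ?thesis
    by (simp add: distributed_def)
qed

section \<open>Product measures\<close>

text \<open>A product measure is determined by boxes, and on a box the integral of a product of
  one-coordinate functions factorises.\<close>

lemma PiM_density:
  fixes N :: "'i \<Rightarrow> 'a measure"
  assumes I: "finite I"
    and sf: "\<And>i. i \<in> I \<Longrightarrow> sigma_finite_measure (N i)"
    and f: "\<And>i. i \<in> I \<Longrightarrow> f i \<in> borel_measurable (N i)"
    and sfd: "\<And>i. i \<in> I \<Longrightarrow> sigma_finite_measure (density (N i) (f i))"
  shows "density (PiM I N) (\<lambda>x. \<Prod>i\<in>I. f i (x i)) = PiM I (\<lambda>i. density (N i) (f i))"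
proof -
  \<comment> \<open>\<open>product_sigma_finite\<close> demands sigma-finiteness at every index;
    outside \<open>I\<close> the family is filled with the trivial empty space, which leaves the
    product over \<open>I\<close> unchanged.\<close>
  define N' where "N' i = (if i \<in> I then N i else count_space {})" for i
  define D where "D i = (if i \<in> I then density (N i) (f i) else count_space {})" for i
  interpret N': product_sigma_finite N'
    using sf by (auto simp: N'_def product_sigma_finite_def sigma_finite_measure_count_space_finite)
  interpret D: product_sigma_finite D
    using sfd by (auto simp: D_def product_sigma_finite_def sigma_finite_measure_count_space_finite)
  have N: "PiM I N = PiM I N'"
    by (rule PiM_cong) (auto simp: N'_def)
  have f' [measurable]: "f i \<in> borel_measurable (N' i)" if "i \<in> I" for i
    using that f by (simp add: N'_def)
  have "density (PiM I N') (\<lambda>x. \<Prod>i\<in>I. f i (x i)) = PiM I D"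
  proof (rule D.PiM_eqI)
    show "sets (density (PiM I N') (\<lambda>x. \<Prod>i\<in>I. f i (x i))) = sets (PiM I D)"
      by (auto intro!: sets_PiM_cong simp: N'_def D_def)
    fix A assume "\<And>i. i \<in> I \<Longrightarrow> A i \<in> sets (D i)"
    then have A [measurable]: "A i \<in> sets (N' i)" if "i \<in> I" for i
      using that by (auto simp: D_def N'_def)
    have "emeasure (density (PiM I N') (\<lambda>x. \<Prod>i\<in>I. f i (x i))) (Pi\<^sub>E I A)
        = (\<integral>\<^sup>+x. (\<Prod>i\<in>I. f i (x i)) * indicator (Pi\<^sub>E I A) x \<partial>PiM I N')"
      using I by (intro emeasure_density) (auto intro!: sets_PiM_I_finite)
    also have "\<dots> = (\<integral>\<^sup>+x. (\<Prod>i\<in>I. f i (x i) * indicator (A i) (x i)) \<partial>PiM I N')"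
    proof (rule nn_integral_cong)
      fix x assume "x \<in> space (PiM I N')"
      then have "indicator (Pi\<^sub>E I A) x = (\<Prod>i\<in>I. indicator (A i) (x i) :: ennreal)"
        using I by (auto simp: indicator_def space_PiM PiE_iff prod_zero_iff)
      then show "(\<Prod>i\<in>I. f i (x i)) * indicator (Pi\<^sub>E I A) x
          = (\<Prod>i\<in>I. f i (x i) * indicator (A i) (x i))"
        by (simp add: prod.distrib)
    qed
    also have "\<dots> = (\<Prod>i\<in>I. \<integral>\<^sup>+x. f i x * indicator (A i) x \<partial>N' i)"
      by (intro N'.product_nn_integral_prod I) measurable
    also have "\<dots> = (\<Prod>i\<in>I. emeasure (D i) (A i))"
    proof (rule prod.cong)
      fix i assume i: "i \<in> I"
      then show "(\<integral>\<^sup>+x. f i x * indicator (A i) x \<partial>N' i) = emeasure (D i) (A i)"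
        using f[OF i] A[OF i] by (simp add: D_def N'_def emeasure_density)
    qed simp
    finally show "emeasure (density (PiM I N') (\<lambda>x. \<Prod>i\<in>I. f i (x i))) (Pi\<^sub>E I A)
        = (\<Prod>i\<in>I. emeasure (D i) (A i))" .
  qed (fact I)
  also have "PiM I D = PiM I (\<lambda>i. density (N i) (f i))"
    by (rule PiM_cong) (auto simp: D_def)
  finally show ?thesis
    by (simp add: N)
qed

lemma integral_PiM_prod:
  fixes f :: "'i \<Rightarrow> 'a \<Rightarrow> real"
  assumes I: "finite I"
    and sf: "\<And>i. i \<in> I \<Longrightarrow> sigma_finite_measure (N i)"
    and f: "\<And>i. i \<in> I \<Longrightarrow> integrable (N i) (f i)"
  shows "(\<integral>x. (\<Prod>i\<in>I. f i (x i)) \<partial>PiM I N) = (\<Prod>i\<in>I. \<integral>x. f i x \<partial>N i)"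
proof -
  define N' where "N' i = (if i \<in> I then N i else count_space {})" for i
  interpret N': product_sigma_finite N'
    using sf by (auto simp: N'_def product_sigma_finite_def sigma_finite_measure_count_space_finite)
  have "PiM I N = PiM I N'"
    by (rule PiM_cong) (auto simp: N'_def)
  moreover have "(\<integral>x. (\<Prod>i\<in>I. f i (x i)) \<partial>PiM I N') = (\<Prod>i\<in>I. \<integral>x. f i x \<partial>N' i)"
    using f by (intro N'.product_integral_prod I) (simp add: N'_def)
  ultimately show ?thesis
    by (simp add: N'_def)
qed

text \<open>Independence amounts to the tuple of coordinates having a product law; on a product
  space that tuple is the point itself.\<close>

lemma indep_vars_PiM_coordinates:
  assumes D: "\<And>i. i \<in> I \<Longrightarrow> prob_space (D i)" and "I \<noteq> {}"
    and Z: "\<And>i. i \<in> I \<Longrightarrow> Z i \<in> measurable (D i) (T i)"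
  shows "prob_space.indep_vars (PiM I D) T (\<lambda>i x. Z i (x i)) I"
proof -
  interpret prob_space "PiM I D"
    using D by (rule prob_space_PiM)
  \<comment> \<open>Points of the product space are extensional, so restricting them to
    \<open>I\<close> changes nothing.\<close>
  have "distr (PiM I D) (PiM I D) (\<lambda>x. \<lambda>i\<in>I. x i) = distr (PiM I D) (PiM I D) (\<lambda>x. x)"
    by (rule distr_cong) (auto simp: space_PiM PiE_def extensional_restrict)
  also have "\<dots> = PiM I D"
    by simp
  also have "PiM I D = PiM I (\<lambda>i. distr (PiM I D) (D i) (\<lambda>x. x i))"
    using D by (intro PiM_cong) (auto simp: distr_PiM_component)
  finally have "indep_vars D (\<lambda>i x. x i) I"
    using assms by (subst indep_vars_iff_distr_eq_PiM') auto
  then show ?thesis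
    using Z by (rule indep_vars_compose2)
qed

lemma distr_PiM_restrict:
  assumes D: "\<And>i. i \<in> I \<Longrightarrow> prob_space (D i)" and "J \<subseteq> I"
  shows "distr (PiM I D) (PiM J D) (\<lambda>x. restrict x J) = PiM J D"
  using distr_PiM_reindex[of I D "\<lambda>i. i" J] assms by auto

lemma distr_PiM_subset:
  assumes D: "\<And>i. i \<in> I \<Longrightarrow> prob_space (D i)" and J: "J \<subseteq> I"
    and f: "f \<in> measurable (PiM J D) N" and eq: "\<And>x. f (restrict x J) = f x"
  shows "distr (PiM I D) N f = distr (PiM J D) N f"
proof -
  have "distr (PiM J D) N f = distr (distr (PiM I D) (PiM J D) (\<lambda>x. restrict x J)) N f"
    by (simp add: distr_PiM_restrict[OF D J])
  also have "\<dots> = distr (PiM I D) N f"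
    using f J by (subst distr_distr) (auto simp: comp_def eq measurable_restrict_subset)
  finally show ?thesis ..
qed

text \<open>Independence of the generated sigma-algebras gives the product rule on rectangles, and
  these determine the joint law.\<close>

lemma (in prob_space) indep_rvs_joint_law:
  assumes "indep_rvs M S X T Y"
  shows "distr M (S \<Otimes>\<^sub>M T) (\<lambda>w. (X w, Y w)) = distr M S X \<Otimes>\<^sub>M distr M T Y"
proof -
  have [measurable]: "X \<in> measurable M S" "Y \<in> measurable M T"
    using assms by (auto simp: indep_rvs_def)
  interpret X: prob_space "distr M S X" by (rule prob_space_distr) fact
  interpret Y: prob_space "distr M T Y" by (rule prob_space_distr) fact
  show ?thesis
  proof (rule pair_measure_eqI[symmetric])
    fix A B assume AB [measurable]: "A \<in> sets (distr M S X)" "B \<in> sets (distr M T Y)"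
    have "prob ((X -` A \<inter> space M) \<inter> (Y -` B \<inter> space M))
        = prob (X -` A \<inter> space M) * prob (Y -` B \<inter> space M)"
      using assms AB unfolding indep_rvs_def by (intro indep_setD) auto
    moreover have "(\<lambda>w. (X w, Y w)) -` (A \<times> B) \<inter> space M = (X -` A \<inter> space M) \<inter> (Y -` B \<inter> space M)"
      by auto
    ultimately show "emeasure (distr M S X) A * emeasure (distr M T Y) B
        = emeasure (distr M (S \<Otimes>\<^sub>M T) (\<lambda>w. (X w, Y w))) (A \<times> B)"
      using AB by (simp add: emeasure_distr emeasure_eq_measure ennreal_mult)
  qed (auto intro: X.sigma_finite_measure_axioms Y.sigma_finite_measure_axioms)
qed

lemma (in prob_space) integrable_of_variance_pos:
  fixes X :: "'a \<Rightarrow> real"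
  assumes X: "random_variable borel X" and pos: "0 < variance X"
  shows "integrable M X" "integrable M (\<lambda>w. (X w)\<^sup>2)"
proof -
  define Y where "Y w = X w - expectation X" for w
  have X_eq: "X = (\<lambda>w. Y w + expectation X)"
    by (simp add: Y_def)
  have Y: "random_variable borel Y"
    unfolding Y_def[abs_def] using X by measurable
  \<comment> \<open>The integral of a non-integrable function is 0 by convention, so a positive
    variance certifies integrability. Here \<open>expectation X\<close> is merely some real
    constant.\<close>
  have sq: "integrable M (\<lambda>w. (Y w)\<^sup>2)"
    using pos not_integrable_integral_eq[of M "\<lambda>w. (Y w)\<^sup>2"] unfolding Y_def by (metis less_irrefl)
  have int: "integrable M Y"
    using Y sq by (rule square_integrable_imp_integrable)
  show "integrable M X"
    by (subst X_eq) (use int in simp)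
  show "integrable M (\<lambda>w. (X w)\<^sup>2)"
    by (subst X_eq) (use int sq in \<open>simp add: power2_sum\<close>)
qed

section \<open>The target conditional law as a product of tilted blocks\<close>

text \<open>\<open>prior_pos\<close> keeps the denominator of the conditional density nonzero, and
  \<open>est_pos\<close> excludes, up to null sets, the default value
  \<open>ln 0 = 0\<close>.\<close>

locale fixed_param_model =
  fixes B :: "('t, 'u) block_model" and \<theta> :: 't
  assumes valid: "valid_block_model B"
    and theta: "\<theta> \<in> space (param_ref B)"
    and prior_pos: "0 < prior B \<theta>"
    and est_pos: "\<And>j. j \<in> blocks B \<Longrightarrow> AE x in block_law B j. 0 < lik_est B j \<theta> x"
begin

text \<open>This turns out to be the law of a single block under the target given \<theta>.\<close>

definition tilted_law :: "nat \<Rightarrow> 'u measure" where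
  "tilted_law j = density (block_law B j) (\<lambda>x. ennreal (exp (log_err B j \<theta> x)))"

lemma finite_blocks [simp]: "finite (blocks B)"
  by (simp add: blocks_def)

lemma sets_block_law [simp, measurable_cong]: "sets (block_law B j) = sets (aux_ref B j)"
  by (simp add: block_law_def)

lemma space_block_law [simp]: "space (block_law B j) = space (aux_ref B j)"
  by (simp add: block_law_def)

lemma sets_tilted_law [simp, measurable_cong]: "sets (tilted_law j) = sets (aux_ref B j)"
  by (simp add: tilted_law_def)

context
  fixes j assumes j: "j \<in> blocks B"
begin

lemma sigma_finite_aux_ref: "sigma_finite_measure (aux_ref B j)"
  and dens_measurable [measurable]: "aux_dens B j \<in> borel_measurable (aux_ref B j)"
  and dens_nonneg: "\<And>x. x \<in> space (aux_ref B j) \<Longrightarrow> 0 \<le> aux_dens B j x"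
  and dens_integral: "has_bochner_integral (aux_ref B j) (aux_dens B j) 1"
  and est_nonneg: "\<And>x. x \<in> space (aux_ref B j) \<Longrightarrow> 0 \<le> lik_est B j \<theta> x"
  and unbiased: "has_bochner_integral (aux_ref B j) (\<lambda>u. lik_est B j \<theta> u * aux_dens B j u) (lik B j \<theta>)"
  using valid j theta unfolding valid_block_model_def by blast+

lemma est_measurable [measurable]: "lik_est B j \<theta> \<in> borel_measurable (aux_ref B j)"
proof -
  have "(\<lambda>(\<theta>, u). lik_est B j \<theta> u) \<in> borel_measurable (param_ref B \<Otimes>\<^sub>M aux_ref B j)"
    using valid j unfolding valid_block_model_def by blast
  from measurable_compose[OF measurable_Pair1'[OF theta] this] show ?thesis
    by simp
qed

lemma log_err_measurable [measurable]: "log_err B j \<theta> \<in> borel_measurable (aux_ref B j)"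
  unfolding log_err_def[abs_def] by measurable

lemma prob_space_block_law: "prob_space (block_law B j)"
proof
  have "emeasure (block_law B j) (space (block_law B j)) = (\<integral>\<^sup>+x. ennreal (aux_dens B j x) \<partial>aux_ref B j)"
    by (simp add: block_law_def emeasure_density cong: nn_integral_cong)
  also have "\<dots> = ennreal (\<integral>x. aux_dens B j x \<partial>aux_ref B j)"
    using dens_integral dens_nonneg by (intro nn_integral_eq_integral) (auto intro: has_bochner_integral_integrable simp: has_bochner_integral_iff)
  finally show "emeasure (block_law B j) (space (block_law B j)) = 1"
    using dens_integral by (simp add: has_bochner_integral_iff)
qed

text \<open>By unbiasedness the likelihood factor is the mean of a nonnegative estimate; a zero mean
  would make the estimate vanish almost surely, against \<open>est_pos\<close>.\<close>

lemma lik_pos: "0 < lik B j \<theta>"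
proof -
  interpret prob_space "block_law B j" by (rule prob_space_block_law)
  have int: "integrable (block_law B j) (lik_est B j \<theta>)"
    unfolding block_law_def using unbiased dens_nonneg
    by (subst integrable_density) (auto simp: has_bochner_integral_iff mult.commute)
  have "lik B j \<theta> = expectation (lik_est B j \<theta>)"
    unfolding block_law_def using unbiased dens_nonneg
    by (subst integral_density) (auto simp: has_bochner_integral_iff mult.commute)
  moreover have "expectation (lik_est B j \<theta>) \<noteq> 0"
  proof
    assume "expectation (lik_est B j \<theta>) = 0"
    then have "AE x in block_law B j. lik_est B j \<theta> x = 0"
      using integral_nonneg_eq_0_iff_AE[OF int AE_I2] est_nonneg by simp
    with est_pos[OF j] have "AE x in block_law B j. False"
      by eventually_elim simp
    then show False
      by simp
  qed
  moreover have "0 \<le> expectation (lik_est B j \<theta>)"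
    using est_nonneg by (intro integral_nonneg_AE) auto
  ultimately show ?thesis
    by linarith
qed

text \<open>Where the estimate is positive, the exponential of the error is the ratio of estimate to
  likelihood; the remaining points form a null set of the block law.\<close>

lemma tilted_law_eq:
  "tilted_law j = density (aux_ref B j)
     (\<lambda>x. ennreal (lik_est B j \<theta> x * aux_dens B j x / lik B j \<theta>))"
proof -
  have "tilted_law j = density (block_law B j) (\<lambda>x. ennreal (lik_est B j \<theta> x / lik B j \<theta>))"
    unfolding tilted_law_def
  proof (rule density_cong)
    show "AE x in block_law B j. ennreal (exp (log_err B j \<theta> x)) = ennreal (lik_est B j \<theta> x / lik B j \<theta>)"
      using est_pos[OF j]
      by eventually_elim (simp add: log_err_def exp_diff lik_pos)
  qed measurable
  also have "\<dots> = density (aux_ref B j)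
      (\<lambda>x. ennreal (aux_dens B j x) * ennreal (lik_est B j \<theta> x / lik B j \<theta>))"
    unfolding block_law_def by (rule density_density_eq) measurable
  also have "\<dots> = density (aux_ref B j) (\<lambda>x. ennreal (lik_est B j \<theta> x * aux_dens B j x / lik B j \<theta>))"
    using dens_nonneg by (intro density_cong) (auto simp: mult.commute simp flip: ennreal_mult')
  finally show ?thesis .
qed

text \<open>Total mass 1 is exactly unbiasedness divided by the likelihood factor.\<close>

lemma prob_space_tilted_law: "prob_space (tilted_law j)"
proof
  have "emeasure (tilted_law j) (space (tilted_law j))
      = (\<integral>\<^sup>+x. ennreal (lik_est B j \<theta> x * aux_dens B j x / lik B j \<theta>) \<partial>aux_ref B j)"
    by (simp add: tilted_law_eq emeasure_density cong: nn_integral_cong)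
  also have "\<dots> = ennreal (\<integral>x. lik_est B j \<theta> x * aux_dens B j x / lik B j \<theta> \<partial>aux_ref B j)"
    using unbiased dens_nonneg est_nonneg lik_pos
    by (intro nn_integral_eq_integral) (auto simp: has_bochner_integral_iff)
  finally show "emeasure (tilted_law j) (space (tilted_law j)) = 1"
    using unbiased lik_pos by (simp add: has_bochner_integral_iff)
qed

end

section \<open>Factorisation of the target conditional law and tilting of normal errors\<close>

lemma sub_log_err_measurable:
  "J \<subseteq> blocks B \<Longrightarrow> sub_log_err B J \<theta> \<in> borel_measurable (PiM J (aux_ref B))"
  unfolding sub_log_err_def[abs_def] by measurable auto

text \<open>The factor of prior over marginal likelihood cancels, and the normalising integral
  splits into one unbiasedness identity per block.\<close>

lemma target_cond_dens_eq:
  assumes "x \<in> space (aux_space B)"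
  shows "target_cond_dens B \<theta> x
    = (\<Prod>j\<in>blocks B. lik_est B j \<theta> (x j) * aux_dens B j (x j) / lik B j \<theta>)"
proof -
  let ?c = "prior B \<theta> / marginal_lik B"
  have c: "?c \<noteq> 0"
    using prior_pos valid by (auto simp: valid_block_model_def)
  have td: "target_dens B \<theta> y = ?c * (\<Prod>j\<in>blocks B. lik_est B j \<theta> (y j) * aux_dens B j (y j))" for y
    by (simp add: target_dens_def full_lik_est_def prod.distrib)
  have "(\<integral>y. target_dens B \<theta> y \<partial>aux_space B) = ?c * (\<Prod>j\<in>blocks B. lik B j \<theta>)"
    unfolding td aux_space_def
    using unbiased sigma_finite_aux_ref
    by (subst integral_mult_right_zero, subst integral_PiM_prod) (auto simp: has_bochner_integral_iff)
  then show ?thesis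
    using c by (simp add: target_cond_dens_def td prod_dividef)
qed

text \<open>Since the conditional density is a product over blocks, the blocks remain independent
  under the target given \<theta>.\<close>

lemma target_cond_eq: "target_cond B \<theta> = PiM (blocks B) tilted_law"
proof -
  let ?f = "\<lambda>j x. ennreal (lik_est B j \<theta> x * aux_dens B j x / lik B j \<theta>)"
  have "target_cond B \<theta> = density (aux_space B) (\<lambda>x. \<Prod>j\<in>blocks B. ?f j (x j))"
    unfolding target_cond_def
  proof (rule density_cong)
    have "ennreal (target_cond_dens B \<theta> x) = (\<Prod>j\<in>blocks B. ?f j (x j))"
      if x: "x \<in> space (aux_space B)" for x
    proof -
      have "x j \<in> space (aux_ref B j)" if "j \<in> blocks B" for j
        using x that by (auto simp: aux_space_def space_PiM)
      then show ?thesis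
        unfolding target_cond_dens_eq[OF x]
        by (intro prod_ennreal[symmetric]) (simp add: est_nonneg dens_nonneg lik_pos less_imp_le)
    qed
    note eq = this
    show "AE x in aux_space B. ennreal (target_cond_dens B \<theta> x) = (\<Prod>j\<in>blocks B. ?f j (x j))"
      using eq by auto
    show m: "(\<lambda>x. \<Prod>j\<in>blocks B. ?f j (x j)) \<in> borel_measurable (aux_space B)"
      unfolding aux_space_def by measurable
    show "(\<lambda>x. ennreal (target_cond_dens B \<theta> x)) \<in> borel_measurable (aux_space B)"
      using m by (subst measurable_cong[OF eq])
  qed
  also have "\<dots> = PiM (blocks B) (\<lambda>j. density (aux_ref B j) (?f j))"
    unfolding aux_space_def
  proof (rule PiM_density)
    show "sigma_finite_measure (density (aux_ref B j) (?f j))" if "j \<in> blocks B" for j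
      using prob_space_tilted_law[OF that] unfolding tilted_law_eq[OF that]
      by (rule prob_space_imp_sigma_finite)
  qed (simp_all add: sigma_finite_aux_ref)
  also have "\<dots> = PiM (blocks B) tilted_law"
    by (rule PiM_cong) (simp_all add: tilted_law_eq)
  finally show ?thesis .
qed

lemma PiM_tilted_law:
  assumes "J \<subseteq> blocks B"
  shows "PiM J tilted_law = density (PiM J (block_law B)) (\<lambda>x. ennreal (exp (sub_log_err B J \<theta> x)))"
proof -
  have J: "finite J" "\<And>j. j \<in> J \<Longrightarrow> j \<in> blocks B"
    using assms finite_subset[OF assms] by auto
  have "PiM J tilted_law = density (PiM J (block_law B))
      (\<lambda>x. \<Prod>j\<in>J. ennreal (exp (log_err B j \<theta> (x j))))"
    unfolding tilted_law_def[abs_def]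
    using J prob_space_tilted_law
    by (intro PiM_density[symmetric])
      (auto intro!: prob_space_imp_sigma_finite prob_space_block_law simp flip: tilted_law_def)
  also have "(\<lambda>x. \<Prod>j\<in>J. ennreal (exp (log_err B j \<theta> (x j)))) = (\<lambda>x. ennreal (exp (sub_log_err B J \<theta> x)))"
    using J by (simp add: sub_log_err_def exp_sum prod_ennreal)
  finally show ?thesis .
qed

text \<open>The total mass of the tilted law is the moment generating function of the untilted error
  at 1; being 1, it fixes the mean. Since the tilt depends on the blocks only through the error, it
  commutes with pushing forward.\<close>

lemma
  assumes J: "J \<subseteq> blocks B" and b: "0 \<le> b"
    and law: "distr (PiM J (block_law B)) borel (sub_log_err B J \<theta>) = normal_law a b"
  shows normal_sub_log_err_mean: "a = - (b\<^sup>2 / 2)"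
    and normal_sub_log_err_tilted:
      "distr (PiM J tilted_law) borel (sub_log_err B J \<theta>) = normal_law (b\<^sup>2 / 2) b"
proof -
  have [measurable]: "sub_log_err B J \<theta> \<in> borel_measurable (PiM J (block_law B))"
    using sub_log_err_measurable[OF J] by (simp cong: measurable_cong_sets sets_PiM_cong)
  interpret prob_space "PiM J tilted_law"
    using J prob_space_tilted_law by (intro prob_space_PiM) auto
  have "1 = emeasure (PiM J tilted_law) (space (PiM J tilted_law))"
    by (simp add: emeasure_space_1)
  also have "\<dots> = (\<integral>\<^sup>+x. ennreal (exp x) \<partial>distr (PiM J (block_law B)) borel (sub_log_err B J \<theta>))"
    unfolding PiM_tilted_law[OF J]
    by (simp add: emeasure_density nn_integral_distr cong: nn_integral_cong)
  also have "\<dots> = ennreal (exp (a + b\<^sup>2 / 2))"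
    unfolding law by (rule nn_integral_exp_normal_law[OF b])
  finally have "exp (a + b\<^sup>2 / 2) = 1"
    by (metis ennreal_1 ennreal_inj exp_ge_zero zero_le_one)
  then show a: "a = - (b\<^sup>2 / 2)"
    by simp
  have "distr (PiM J tilted_law) borel (sub_log_err B J \<theta>)
      = density (distr (PiM J (block_law B)) borel (sub_log_err B J \<theta>)) (\<lambda>x. ennreal (exp x))"
    unfolding PiM_tilted_law[OF J] by (rule density_distr[symmetric]) measurable
  then show "distr (PiM J tilted_law) borel (sub_log_err B J \<theta>) = normal_law (b\<^sup>2 / 2) b"
    using density_exp_normal_law[OF b] by (simp add: law a)
qed

lemma log_errs_indep:
  assumes "\<And>j. j \<in> blocks B \<Longrightarrow> prob_space (D j)" "\<And>j. j \<in> blocks B \<Longrightarrow> sets (D j) = sets (aux_ref B j)"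
    and "J \<subseteq> blocks B" "J \<noteq> {}"
  shows "prob_space.indep_vars (PiM J D) (\<lambda>_. borel) (\<lambda>j x. log_err B j \<theta> (x j)) J"
proof (rule indep_vars_PiM_coordinates)
  show "log_err B j \<theta> \<in> borel_measurable (D j)" if "j \<in> J" for j
  proof -
    have "j \<in> blocks B"
      using that assms by auto
    then show ?thesis
      using assms log_err_measurable[of j] measurable_cong_sets[of "D j" "aux_ref B j" borel borel]
      by auto
  qed
qed (use assms in auto)

text \<open>The block laws \<open>D\<close> are kept general, so that the fact serves both
  \<open>block_law\<close> and \<open>tilted_law\<close>.\<close>

lemma log_err_indep_rest:
  assumes D: "\<And>j. j \<in> blocks B \<Longrightarrow> prob_space (D j)" "\<And>j. j \<in> blocks B \<Longrightarrow> sets (D j) = sets (aux_ref B j)"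
    and k: "k \<in> blocks B"
  shows "prob_space.indep_var (PiM (blocks B) D) borel (\<lambda>x. log_err B k \<theta> (x k))
    borel (sub_log_err B (blocks B - {k}) \<theta>)"
proof -
  interpret prob_space "PiM (blocks B) D"
    using D by (intro prob_space_PiM) auto
  have "indep_vars (\<lambda>_. borel) (\<lambda>j x. log_err B j \<theta> (x j)) (blocks B)"
    using D k by (intro log_errs_indep) auto
  then have "indep_vars (\<lambda>_. borel) (\<lambda>j x. log_err B j \<theta> (x j)) (insert k (blocks B - {k}))"
    using k by (simp add: insert_absorb)
  from indep_vars_sum[OF _ _ this] show ?thesis
    by (simp add: sub_log_err_def[abs_def])
qed

lemma distr_log_err:
  assumes "\<And>j. j \<in> blocks B \<Longrightarrow> prob_space (D j)" "\<And>j. j \<in> blocks B \<Longrightarrow> sets (D j) = sets (aux_ref B j)"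
    and k: "k \<in> blocks B"
  shows "distr (PiM (blocks B) D) borel (\<lambda>x. log_err B k \<theta> (x k)) = distr (D k) borel (log_err B k \<theta>)"
proof -
  have [measurable]: "log_err B k \<theta> \<in> borel_measurable (D k)"
    using assms log_err_measurable[of k] measurable_cong_sets[of "D k" "aux_ref B k" borel borel]
    by auto
  have "distr (D k) borel (log_err B k \<theta>)
      = distr (distr (PiM (blocks B) D) (D k) (\<lambda>x. x k)) borel (log_err B k \<theta>)"
    using assms by (simp add: distr_PiM_component)
  also have "\<dots> = distr (PiM (blocks B) D) borel (\<lambda>x. log_err B k \<theta> (x k))"
    using k by (subst distr_distr) (auto simp: comp_def)
  finally show ?thesis ..
qed

lemma distr_sub_log_err:
  assumes "\<And>j. j \<in> blocks B \<Longrightarrow> prob_space (D j)" "\<And>j. j \<in> blocks B \<Longrightarrow> sets (D j) = sets (aux_ref B j)"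
    and J: "J \<subseteq> blocks B"
  shows "distr (PiM (blocks B) D) borel (sub_log_err B J \<theta>) = distr (PiM J D) borel (sub_log_err B J \<theta>)"
proof (rule distr_PiM_subset)
  have "sets (PiM J D) = sets (PiM J (aux_ref B))"
    using assms by (intro sets_PiM_cong) auto
  then show "sub_log_err B J \<theta> \<in> borel_measurable (PiM J D)"
    using sub_log_err_measurable[OF J] measurable_cong_sets by blast
qed (use assms in \<open>auto simp: sub_log_err_def\<close>)

end

section \<open>Laws of the block errors under Assumption A\<close>

locale normal_block_model = fixed_param_model B \<theta>
  for B :: "('t, 'u) block_model" and \<theta> :: 't +
  fixes \<gamma> :: "nat \<Rightarrow> 't \<Rightarrow> real" and \<omega> \<sigma> :: real and k :: nat
  assumes A: "assumption_A B \<theta> \<gamma> \<omega> \<sigma>" and k: "k \<in> blocks B"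
begin

abbreviation "rest \<equiv> blocks B - {k}"
text \<open>The variance of one block error. With \<open>d\<close> other blocks, the rest has
  variance \<open>c * d\<close> and the total \<open>c * (d + 1)\<close>.\<close>

definition c :: real where "c = \<sigma>\<^sup>2 / real (nblocks B)"
abbreviation "d \<equiv> real (card rest)"

lemma nblocks_pos: "0 < nblocks B"
  using k by (simp add: blocks_def)

lemma card_rest: "d + 1 = real (nblocks B)"
proof -
  have "card (blocks B) = nblocks B" by (simp add: blocks_def)
  then show ?thesis
    using k nblocks_pos by (simp add: card_Diff_singleton)
qed

lemma c_pos: "0 < c"
  using A nblocks_pos by (simp add: assumption_A_def c_def)

lemma sigma2_eq: "\<sigma>\<^sup>2 = c * (d + 1)"
  using nblocks_pos by (simp add: card_rest c_def)

sublocale aux: prob_space "aux_law B"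
  unfolding aux_law_def by (rule prob_space_PiM) (rule prob_space_block_law)

lemma sub_log_err_measurable_aux [measurable]:
  "J \<subseteq> blocks B \<Longrightarrow> sub_log_err B J \<theta> \<in> borel_measurable (aux_law B)"
  unfolding aux_law_def sub_log_err_def[abs_def] by measurable auto

lemma log_err_measurable_aux [measurable]:
  "j \<in> blocks B \<Longrightarrow> (\<lambda>x. log_err B j \<theta> (x j)) \<in> borel_measurable (aux_law B)"
  unfolding aux_law_def by measurable

lemma variance_log_err:
  assumes j: "j \<in> blocks B"
  shows "aux.variance (\<lambda>x. log_err B j \<theta> (x j)) = c"
proof -
  have w: "0 < \<omega>" and s: "0 < \<sigma>\<^sup>2" and g: "0 < (\<gamma> j \<theta>)\<^sup>2"
    and v: "aux.variance (\<lambda>x. log_err B j \<theta> (x j)) = (\<gamma> j \<theta>)\<^sup>2 / nsamples B j powr (2 * \<omega>)"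
    and n: "nsamples B j = (real (nblocks B) * (\<gamma> j \<theta>)\<^sup>2 / \<sigma>\<^sup>2) powr (1 / (2 * \<omega>))"
    using A j unfolding assumption_A_def by blast+
  have "0 < real (nblocks B) * (\<gamma> j \<theta>)\<^sup>2 / \<sigma>\<^sup>2"
    using nblocks_pos s g by simp
  \<comment> \<open>The exponents \<open>1 / (2 * \<omega>)\<close> and \<open>2 * \<omega>\<close>
    cancel, and positivity of the base collapses the power 1.\<close>
  then have "nsamples B j powr (2 * \<omega>) = real (nblocks B) * (\<gamma> j \<theta>)\<^sup>2 / \<sigma>\<^sup>2"
    using w by (simp add: n powr_powr)
  then show ?thesis
    using g s nblocks_pos by (simp add: v c_def)
qed

lemma variance_sub_log_err:
  assumes J: "J \<subseteq> blocks B"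
  shows "aux.variance (sub_log_err B J \<theta>) = real (card J) * c"
proof -
  have "aux.indep_vars (\<lambda>_. borel) (\<lambda>j x. log_err B j \<theta> (x j)) (blocks B)"
    unfolding aux_law_def using prob_space_block_law k by (intro log_errs_indep) auto
  then have "aux.indep_vars (\<lambda>_. borel) (\<lambda>j x. log_err B j \<theta> (x j)) J"
    using J by (rule aux.indep_vars_subset)
  \<comment> \<open>Square integrability of each summand comes from its positive variance
    \<open>c\<close>.\<close>
  then have "aux.variance (\<lambda>x. \<Sum>j\<in>J. log_err B j \<theta> (x j))
      = (\<Sum>j\<in>J. aux.variance (\<lambda>x. log_err B j \<theta> (x j)))"
    using J c_pos variance_log_err
    by (intro aux.variance_sum_indep[THEN conjunct1] aux.integrable_of_variance_pos)
      (auto intro: finite_subset)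
  also have "\<dots> = (\<Sum>j\<in>J. c)"
    using J variance_log_err by (intro sum.cong) auto
  finally show ?thesis
    by (simp add: sub_log_err_def[abs_def])
qed

text \<open>Matching variances fixes the standard deviation only; the mean stays unknown until
  unbiasedness is brought in.\<close>

lemma normal_sub_log_err:
  assumes J: "J \<subseteq> blocks B" and N: "normally_distributed (aux_law B) (sub_log_err B J \<theta>)"
  obtains a where "distr (aux_law B) borel (sub_log_err B J \<theta>) = normal_law a (sqrt (c * card J))"
proof -
  obtain a b where b: "0 \<le> b" and law: "distr (aux_law B) borel (sub_log_err B J \<theta>) = normal_law a b"
    using N by (auto simp: normally_distributed_def)
  have m: "sub_log_err B J \<theta> \<in> borel_measurable (aux_law B)"
    using J by (rule sub_log_err_measurable_aux)
  have "b\<^sup>2 = c * card J"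
    using aux.variance_if_normal_law[OF m law b] variance_sub_log_err[OF J] by (simp add: mult.commute)
  then have "b = sqrt (c * card J)"
    using b by (metis real_sqrt_unique)
  with law that show thesis
    by blast
qed

text \<open>With a single block, \<open>d = 0\<close> and this is the point mass at 0.\<close>

lemma rest_law:
  shows "distr (PiM rest tilted_law) borel (sub_log_err B rest \<theta>) = normal_law (c * d / 2) (sqrt (c * d))"
proof -
  have "normally_distributed (aux_law B) (sub_log_err B rest \<theta>)"
    using A k by (simp add: assumption_A_def)
  then obtain a where "distr (aux_law B) borel (sub_log_err B rest \<theta>) = normal_law a (sqrt (c * d))"
    by (rule normal_sub_log_err[rotated]) auto
  then have "distr (PiM rest (block_law B)) borel (sub_log_err B rest \<theta>) = normal_law a (sqrt (c * d))"
    unfolding aux_law_def by (subst (asm) distr_sub_log_err) (auto intro: prob_space_block_law)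
  from normal_sub_log_err_tilted[OF _ _ this] show ?thesis
    using c_pos by simp
qed

text \<open>Assumption A gives normality for all blocks together and for all but \<open>k\<close>.
  The total is the independent sum of block \<open>k\<close> and the rest, so deconvolution yields
  normality of block \<open>k\<close> alone.\<close>

lemma block_normal:
  obtains \<mu> where "distr (block_law B k) borel (log_err B k \<theta>) = normal_law \<mu> (sqrt c)"
proof -
  let ?W = "\<lambda>x. log_err B k \<theta> (x k)"
  have pb: "\<And>j. j \<in> blocks B \<Longrightarrow> prob_space (block_law B j)"
    by (rule prob_space_block_law)
  obtain a where a: "distr (aux_law B) borel (sub_log_err B rest \<theta>) = normal_law a (sqrt (c * d))"
    using A k by (auto simp: assumption_A_def intro: normal_sub_log_err[of rest])
  obtain a' where a': "distr (aux_law B) borel (sub_log_err B (blocks B) \<theta>)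
      = normal_law a' (sqrt (c * card (blocks B)))"
    using A k by (auto simp: assumption_A_def intro: normal_sub_log_err[of "blocks B"])
  have card: "real (card (blocks B)) = d + 1"
    by (simp add: card_rest) (simp add: blocks_def)
  have sum: "sub_log_err B (blocks B) \<theta> = (\<lambda>x. ?W x + sub_log_err B rest \<theta> x)"
    using k by (simp add: sub_log_err_def fun_eq_iff sum.remove[of "blocks B" k])
  have ind: "aux.indep_var borel ?W borel (sub_log_err B rest \<theta>)"
    unfolding aux_law_def using pb k by (intro log_err_indep_rest) auto
  have "distr (aux_law B) borel ?W = normal_law (a' - a) (sqrt ((sqrt (c * (d + 1)))\<^sup>2 - (sqrt (c * d))\<^sup>2))"
  proof (rule normal_law_deconvolution)
    show "real_distribution (distr (aux_law B) borel ?W)"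
      using k by (intro aux.real_distribution_distr) auto
    show "sqrt (c * d) \<le> sqrt (c * (d + 1))"
      using c_pos by (intro real_sqrt_le_mono mult_left_mono) auto
    show "char (normal_law a (sqrt (c * d))) t * char (distr (aux_law B) borel ?W) t
        = char (normal_law a' (sqrt (c * (d + 1)))) t" for t
      using aux.char_distr_add[OF ind, of t] a a' by (simp add: card flip: sum)
  qed (use c_pos in auto)
  \<comment> \<open>The variances subtract: \<open>c * (d + 1) - c * d = c\<close>.\<close>
  also have "sqrt ((sqrt (c * (d + 1)))\<^sup>2 - (sqrt (c * d))\<^sup>2) = sqrt c"
    using c_pos by (simp add: algebra_simps)
  also have "distr (aux_law B) borel ?W = distr (block_law B k) borel (log_err B k \<theta>)"
    unfolding aux_law_def using pb k by (intro distr_log_err) auto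
  finally show thesis
    by (rule that)
qed

lemma block_law_normal:
    "distr (block_law B k) borel (log_err B k \<theta>) = normal_law (- (c / 2)) (sqrt c)"
  and tilted_block_law_normal:
    "distr (tilted_law k) borel (log_err B k \<theta>) = normal_law (c / 2) (sqrt c)"
proof -
  \<comment> \<open>Block \<open>k\<close> is viewed as the sub-collection \<open>{k}\<close>, so
    that the results on means and tilting of sub-collections apply to it.\<close>
  have D: "distr (PiM {k} D) borel (sub_log_err B {k} \<theta>) = distr (D k) borel (log_err B k \<theta>)"
    if "prob_space (D k)" "sets (D k) = sets (aux_ref B k)" for D
  proof -
    have [measurable]: "log_err B k \<theta> \<in> borel_measurable (D k)"
      using that k log_err_measurable[of k] measurable_cong_sets[of "D k" "aux_ref B k" borel borel]
      by auto
    have "distr (D k) borel (log_err B k \<theta>)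
        = distr (distr (PiM {k} D) (D k) (\<lambda>x. x k)) borel (log_err B k \<theta>)"
      using that by (subst distr_PiM_component) auto
    also have "\<dots> = distr (PiM {k} D) borel (sub_log_err B {k} \<theta>)"
      by (subst distr_distr) (auto simp: comp_def sub_log_err_def[abs_def])
    finally show ?thesis ..
  qed
  obtain \<mu> where \<mu>: "distr (block_law B k) borel (log_err B k \<theta>) = normal_law \<mu> (sqrt c)"
    by (rule block_normal)
  then have *: "distr (PiM {k} (block_law B)) borel (sub_log_err B {k} \<theta>) = normal_law \<mu> (sqrt c)"
    using k by (subst D) (auto intro: prob_space_block_law)
  have "\<mu> = - (c / 2)"
    using normal_sub_log_err_mean[OF _ _ *] k c_pos by simp
  with \<mu> show "distr (block_law B k) borel (log_err B k \<theta>) = normal_law (- (c / 2)) (sqrt c)"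
    by simp
  show "distr (tilted_law k) borel (log_err B k \<theta>) = normal_law (c / 2) (sqrt c)"
    using normal_sub_log_err_tilted[OF _ _ *] k c_pos D[of tilted_law] prob_space_tilted_law
    by simp
qed

text \<open>Two independences combine: the fresh \<open>v\<close> is independent of
  \<open>u'\<close>, and under the tilted product block \<open>k\<close> is independent of the rest.
  Only the blocks of \<open>u'\<close> are tilted, so the error at \<open>v\<close> keeps the mean
  \<open>- (c / 2)\<close>.\<close>

lemma joint_law:
  assumes "prob_space M"
    and u': "distributed M (aux_space B) u' (\<lambda>x. ennreal (target_cond_dens B \<theta> x))"
    and v: "distributed M (aux_ref B k) v (\<lambda>x. ennreal (aux_dens B k x))"
    and ind: "indep_rvs M (aux_ref B k) v (aux_space B) u'"
  shows "distr M (borel \<Otimes>\<^sub>M (borel \<Otimes>\<^sub>M borel))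
      (\<lambda>w. (log_err B k \<theta> (v w), (log_err B k \<theta> (u' w k), sub_log_err B rest \<theta> (u' w))))
    = normal_law (- (c / 2)) (sqrt c) \<Otimes>\<^sub>M
      (normal_law (c / 2) (sqrt c) \<Otimes>\<^sub>M normal_law (c * d / 2) (sqrt (c * d)))"
proof -
  let ?W = "log_err B k \<theta>" and ?T = "PiM (blocks B) tilted_law"
  let ?Y = "\<lambda>x. (log_err B k \<theta> (x k), sub_log_err B rest \<theta> x)"
  interpret prob_space M by fact
  have pt: "\<And>j. j \<in> blocks B \<Longrightarrow> prob_space (tilted_law j)"
    by (rule prob_space_tilted_law)
  interpret T: prob_space ?T
    using pt by (rule prob_space_PiM)
  have [measurable]: "v \<in> measurable M (aux_ref B k)" "u' \<in> measurable M (aux_space B)"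
    using v u' by (auto simp: distributed_def)
  have [measurable]: "?W \<in> borel_measurable (aux_ref B k)"
    using k by (rule log_err_measurable)
  have sets_T [measurable_cong]: "sets ?T = sets (aux_space B)"
    unfolding aux_space_def by (intro sets_PiM_cong) auto
  have [measurable]: "(\<lambda>x. ?W (x k)) \<in> borel_measurable (aux_space B)"
    "sub_log_err B rest \<theta> \<in> borel_measurable (aux_space B)"
    using k unfolding aux_space_def sub_log_err_def[abs_def] by measurable
  have indT: "T.indep_var borel (\<lambda>x. ?W (x k)) borel (sub_log_err B rest \<theta>)"
    using pt k by (intro log_err_indep_rest) auto
  have "distr ?T borel (\<lambda>x. ?W (x k)) = normal_law (c / 2) (sqrt c)"
    using pt k by (subst distr_log_err) (auto simp: tilted_block_law_normal)
  moreover have "distr ?T borel (sub_log_err B rest \<theta>) = normal_law (c * d / 2) (sqrt (c * d))"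
    using pt by (subst distr_sub_log_err) (auto simp: rest_law)
  ultimately have Y: "distr ?T (borel \<Otimes>\<^sub>M borel) ?Y
      = normal_law (c / 2) (sqrt c) \<Otimes>\<^sub>M normal_law (c * d / 2) (sqrt (c * d))"
    using indT unfolding T.indep_var_distribution_eq by simp
  have law: "distr M (aux_ref B k \<Otimes>\<^sub>M aux_space B) (\<lambda>w. (v w, u' w)) = block_law B k \<Otimes>\<^sub>M ?T"
    using indep_rvs_joint_law[OF ind] u' v
    by (simp add: distributed_def block_law_def target_cond_def[symmetric] target_cond_eq)
  have "distr M (borel \<Otimes>\<^sub>M (borel \<Otimes>\<^sub>M borel)) (\<lambda>w. (?W (v w), ?Y (u' w)))
      = distr (block_law B k \<Otimes>\<^sub>M ?T) (borel \<Otimes>\<^sub>M (borel \<Otimes>\<^sub>M borel)) (\<lambda>(x, y). (?W x, ?Y y))"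
    unfolding law[symmetric] by (subst distr_distr) (auto simp: comp_def)
  also have "\<dots> = distr (block_law B k) borel ?W \<Otimes>\<^sub>M distr ?T (borel \<Otimes>\<^sub>M borel) ?Y"
    by (intro pair_measure_distr[symmetric] prob_space_imp_sigma_finite T.prob_space_distr) measurable
  finally show ?thesis
    by (simp only: Y block_law_normal)
qed

end

section \<open>Joint law and correlation of the two total errors\<close>

theorem lemma2:
  fixes B :: "('t, 'u) block_model"
    and \<theta> :: 't
    and \<gamma> :: "nat \<Rightarrow> 't \<Rightarrow> real"
    and \<omega> \<sigma> \<rho> :: real
    and k :: nat
    and M :: "'w measure"
    and u' :: "'w \<Rightarrow> nat \<Rightarrow> 'u"
    and v :: "'w \<Rightarrow> 'u"
    and z' z :: "'w \<Rightarrow> real"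
  assumes "valid_block_model B"
    and "\<theta> \<in> space (param_ref B)"
    and "0 < prior B \<theta>"
    and "\<forall>j\<in>blocks B. AE x in block_law B j. 0 < lik_est B j \<theta> x"
    and "assumption_A B \<theta> \<gamma> \<omega> \<sigma>"
    and "assumption_B B \<theta>"
    and "\<rho> = 1 - 1 / real (nblocks B)"
    and "k \<in> blocks B"
    and "prob_space M"
    and "distributed M (aux_space B) u' (\<lambda>x. ennreal (target_cond_dens B \<theta> x))"
    and "distributed M (aux_ref B k) v (\<lambda>x. ennreal (aux_dens B k x))"
    and "indep_rvs M (aux_ref B k) v (aux_space B) u'"
    and "z' = (\<lambda>w. sub_log_err B (blocks B) \<theta> (u' w))"
    and "z = (\<lambda>w. sub_log_err B (blocks B) \<theta> ((u' w)(k := v w)))"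
  shows "distributed M lborel (\<lambda>w. vector [z' w, z w] :: real ^ 2)
           (\<lambda>x. ennreal (mv_normal_density
              (vector [\<sigma>\<^sup>2 / 2, - (\<sigma>\<^sup>2 / 2) * (1 - 2 * \<rho>)])
              (\<sigma>\<^sup>2 *\<^sub>R vector [vector [1, \<rho>], vector [\<rho>, 1]]) x))
         \<and> correlation M z z' = \<rho>"
proof -
  interpret normal_block_model B \<theta> \<gamma> \<omega> \<sigma> k
    using assms by unfold_locales auto
  interpret prob_space M by fact
  define W where "W w = log_err B k \<theta> (v w)" for w
  define W' where "W' w = log_err B k \<theta> (u' w k)" for w
  define X where "X w = sub_log_err B rest \<theta> (u' w)" for w
  have z': "z' = (\<lambda>w. W' w + X w)"
    using k by (simp add: assms(13) W'_def X_def sub_log_err_def fun_eq_iff sum.remove[of "blocks B" k])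
  \<comment> \<open>Refreshing block \<open>k\<close> leaves the errors of the other blocks
    untouched, so both totals share the summand \<open>X\<close>.\<close>
  have "(\<Sum>j\<in>rest. log_err B j \<theta> (if j = k then v w else u' w j)) = (\<Sum>j\<in>rest. log_err B j \<theta> (u' w j))" for w
    by (rule sum.cong) auto
  then have z: "z = (\<lambda>w. W w + X w)"
    using k by (simp add: assms(14) W_def X_def sub_log_err_def fun_eq_iff sum.remove[of "blocks B" k])
  have [measurable]: "v \<in> measurable M (aux_ref B k)" "u' \<in> measurable M (aux_space B)"
    using assms by (auto simp: distributed_def)
  have [measurable]: "log_err B k \<theta> \<in> borel_measurable (aux_ref B k)"
    using k by (rule log_err_measurable)
  have [measurable]: "(\<lambda>x. log_err B k \<theta> (x k)) \<in> borel_measurable (aux_space B)"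
    "sub_log_err B rest \<theta> \<in> borel_measurable (aux_space B)"
    using k unfolding aux_space_def sub_log_err_def[abs_def] by measurable
  have [measurable]: "W \<in> borel_measurable M" "W' \<in> borel_measurable M" "X \<in> borel_measurable M"
    unfolding W_def[abs_def] W'_def[abs_def] X_def[abs_def] by measurable
  let ?N1 = "normal_law (c / 2) (sqrt c)" and ?N2 = "normal_law (- (c / 2)) (sqrt c)"
    and ?N3 = "normal_law (c * d / 2) (sqrt (c * d))"
  have law: "distr M (borel \<Otimes>\<^sub>M (borel \<Otimes>\<^sub>M borel)) (\<lambda>w. (W w, (W' w, X w)))
    = ?N2 \<Otimes>\<^sub>M (?N1 \<Otimes>\<^sub>M ?N3)"
    unfolding W_def W'_def X_def by (intro joint_law assms)
  have \<rho>: "\<rho> = d / (d + 1)"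
    using nblocks_pos by (simp add: assms(7) card_rest[symmetric] field_simps)
  have "distributed M lborel (\<lambda>w. vector [W' w + X w, W w + X w] :: real ^ 2)
    (\<lambda>x. ennreal (mv_normal_density (vector [c / 2 + c * d / 2, - (c / 2) + c * d / 2])
           ((c * (d + 1)) *\<^sub>R vector [vector [1, d / (d + 1)], vector [d / (d + 1), 1]]) x))"
    using c_pos law by (intro distributed_normal_common_summand prob_space_axioms) auto
  moreover have "c / 2 + c * d / 2 = \<sigma>\<^sup>2 / 2"
    unfolding sigma2_eq by (simp add: algebra_simps)
  \<comment> \<open>Both sides equal \<open>- (c / 2) * (1 - d)\<close>, because
    \<open>\<sigma>\<^sup>2 = c * (d + 1)\<close> cancels the denominator of
    \<open>1 - 2 * \<rho>\<close>.\<close>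
  moreover have "- (c / 2) + c * d / 2 = - (\<sigma>\<^sup>2 / 2) * (1 - 2 * \<rho>)"
  proof -
    have \<rho>2: "1 - 2 * \<rho> = (1 - d) / (d + 1)"
      by (simp add: \<rho> field_simps)
    have cancel: "- (c * e / 2) * (f / e) = - (c / 2) * f" if "e \<noteq> 0" for e f
      using that by simp
    have "- (\<sigma>\<^sup>2 / 2) * (1 - 2 * \<rho>) = - (c / 2) * (1 - d)"
      unfolding sigma2_eq \<rho>2 by (rule cancel) simp
    then show ?thesis
      by (simp add: algebra_simps)
  qed
  ultimately have joint: "distributed M lborel (\<lambda>w. vector [z' w, z w] :: real ^ 2)
           (\<lambda>x. ennreal (mv_normal_density
              (vector [\<sigma>\<^sup>2 / 2, - (\<sigma>\<^sup>2 / 2) * (1 - 2 * \<rho>)])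
              (\<sigma>\<^sup>2 *\<^sub>R vector [vector [1, \<rho>], vector [\<rho>, 1]]) x))"
    by (simp only: z z' \<rho> sigma2_eq[symmetric])

  have p: "prob_space ?N1" "prob_space ?N2" "prob_space ?N3"
    using c_pos by (auto intro!: prob_space_normal_law)
  interpret N13: pair_prob_space ?N1 ?N3
    using p by (simp add: pair_prob_space_def pair_sigma_finite_def prob_space_imp_sigma_finite)
  have s: "sets (?N1 \<Otimes>\<^sub>M ?N3) = sets (borel \<Otimes>\<^sub>M borel)"
    by (intro sets_pair_measure_cong) auto
  have W'X_rv: "random_variable (borel \<Otimes>\<^sub>M borel) (\<lambda>w. (W' w, X w))"
    by measurable
  note marginals = joint_law_marginals[OF \<open>W \<in> borel_measurable M\<close> W'X_rv p(2) _ N13.prob_space_axioms s law]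
  have W'X: "distr M (borel \<Otimes>\<^sub>M borel) (\<lambda>w. (W' w, X w)) = ?N1 \<Otimes>\<^sub>M ?N3"
    and W: "distr M borel W = ?N2"
    using marginals by auto
  have W': "distr M borel W' = ?N1" and X: "distr M borel X = ?N3"
    using joint_law_marginals[OF _ _ p(1) _ p(3) _ W'X] by auto
  \<comment> \<open>The covariance needs pairwise independence, read off the law of the triple by
    dropping one coordinate of the pair \<open>(W', X)\<close> at a time.\<close>
  have "distr M (borel \<Otimes>\<^sub>M borel) (\<lambda>w. (W w, fst (W' w, X w))) = ?N2 \<Otimes>\<^sub>M distr (?N1 \<Otimes>\<^sub>M ?N3) borel fst"
    by (rule joint_law_compose[OF _ W'X_rv _ _ N13.prob_space_axioms s law]) auto
  also have "distr (?N1 \<Otimes>\<^sub>M ?N3) borel fst = distr (?N1 \<Otimes>\<^sub>M ?N3) ?N1 fst"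
    by (rule distr_cong) auto
  also have "\<dots> = ?N1"
    using p by (simp add: prob_space.distr_pair_fst)
  finally have WW': "indep_var borel W borel W'"
    using p by (intro indep_var_if_joint_law[where P = ?N2 and Q = ?N1]) auto
  have "distr M (borel \<Otimes>\<^sub>M borel) (\<lambda>w. (W w, snd (W' w, X w))) = ?N2 \<Otimes>\<^sub>M distr (?N1 \<Otimes>\<^sub>M ?N3) borel snd"
    by (rule joint_law_compose[OF _ W'X_rv _ _ N13.prob_space_axioms s law]) auto
  also have "distr (?N1 \<Otimes>\<^sub>M ?N3) borel snd = distr (?N1 \<Otimes>\<^sub>M ?N3) ?N3 snd"
    by (rule distr_cong) auto
  also have "\<dots> = ?N3"
    using p by (simp add: distr_snd_prob prob_space_imp_sigma_finite)
  finally have WX: "indep_var borel W borel X"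
    using p by (intro indep_var_if_joint_law[where P = ?N2 and Q = ?N3]) auto
  have W'X_ind: "indep_var borel W' borel X"
    using p W'X by (intro indep_var_if_joint_law[where P = ?N1 and Q = ?N3]) auto

  have nonneg: "0 \<le> sqrt c" "0 \<le> sqrt (c * d)"
    using c_pos by auto
  have moments: "integrable M W" "integrable M (\<lambda>w. (W w)\<^sup>2)" "variance W = c"
    "integrable M W'" "integrable M (\<lambda>w. (W' w)\<^sup>2)" "variance W' = c"
    "integrable M X" "integrable M (\<lambda>w. (X w)\<^sup>2)" "variance X = c * d"
    using integrable_if_normal_law[OF _ W nonneg(1)] integrable_square_if_normal_law[OF _ W nonneg(1)]
      variance_if_normal_law[OF _ W nonneg(1)]
      integrable_if_normal_law[OF _ W' nonneg(1)] integrable_square_if_normal_law[OF _ W' nonneg(1)]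
      variance_if_normal_law[OF _ W' nonneg(1)]
      integrable_if_normal_law[OF _ X nonneg(2)] integrable_square_if_normal_law[OF _ X nonneg(2)]
      variance_if_normal_law[OF _ X nonneg(2)] c_pos
    by auto
  \<comment> \<open>Only \<open>X\<close> is shared, so the covariance is its variance; dividing by
    the common variance \<open>c * (d + 1)\<close> gives \<rho>.\<close>
  have "covariance M z z' = c * d"
    unfolding z z' using moments WW' WX W'X_ind by (subst covariance_add_common) auto
  moreover have "variance z = c * (d + 1)"
    unfolding z using variance_add_indep(1)[OF moments(1,2) moments(7,8) WX] moments
    by (simp add: distrib_left)
  moreover have "variance z' = c * (d + 1)"
    unfolding z' using variance_add_indep(1)[OF moments(4,5) moments(7,8) W'X_ind] moments
    by (simp add: distrib_left)
  ultimately have "correlation M z z' = c * d / (sqrt (c * (d + 1)) * sqrt (c * (d + 1)))"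
    by (simp only: correlation_def)
  also have "\<dots> = \<rho>"
    using c_pos by (simp add: \<rho>)
  finally show ?thesis
    using joint by blast
qed

end
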